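(* Let $0\leq s\leq m$ and let $E\subset\mathbb{R}^m$ be a set satisfying $0<H^s(E)<\infty$ such that for $H^s$-almost every $x\in E$ the limit $$\lim_{\varepsilon\to 0}\int_{|x-y|>\varepsilon}\frac{x-y}{|x-y|^{s+1}}\,dH^s_{|E}(y)$$ exists. Then $s\in\mathbb{Z}$.
   Context: Here $m$ is a positive integer, $s$ is a real number, $H^s$ denotes $s$-dimensional Hausdorff measure in $\mathbb{R}^m$, and $H^s_{|E}$ is its restriction to $E$. Existence of the limit means existence of a limit in $\mathbb{R}^m$ (i.e. finite). *)

theory Defs
  imports "HOL-Analysis.Analysis"
begin

section \<open>Hausdorff measure as an outer measure\<close>

text \<open>
  The \<open>s\<close>-th power of the diameter, with the usual conventions that the empty set contributes
  \<open>0\<close> and that \<open>0\<close> to the power \<open>0\<close> is \<open>1\<close> (whereas \<open>0 powr 0 = 0\<close>), so that the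
  0-dimensional measure is the counting measure.
\<close>

definition diam_pow :: "real \<Rightarrow> 'a::metric_space set \<Rightarrow> ennreal" where
  "diam_pow s U = (if U = {} then 0 else if s = 0 then 1 else ennreal (diameter U powr s))"

text \<open>
  Covering sets are required to be bounded because \<^const>\<open>diameter\<close> is real-valued and carries no
  information on unbounded sets.
  Covers are countable and by arbitrary sets; no normalising constant is used.
\<close>

definition hausdorff_covers :: "real \<Rightarrow> 'a::metric_space set \<Rightarrow> (nat \<Rightarrow> 'a set) set" where
  "hausdorff_covers \<delta> A = {U. A \<subseteq> (\<Union>i. U i) \<and> (\<forall>i. bounded (U i) \<and> diameter (U i) \<le> \<delta>)}"

definition hausdorff_content :: "real \<Rightarrow> real \<Rightarrow> 'a::metric_space set \<Rightarrow> ennreal" where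
  "hausdorff_content s \<delta> A = (INF U\<in>hausdorff_covers \<delta> A. \<Sum>i. diam_pow s (U i))"

definition hausdorff_measure :: "real \<Rightarrow> 'a::metric_space set \<Rightarrow> ennreal" where
  "hausdorff_measure s A = (SUP \<delta>\<in>{0<..}. hausdorff_content s \<delta> A)"

text \<open>
  The restriction to an arbitrary, possibly non-measurable, set \<open>E\<close>, as a Borel measure.
  Lemma \<open>emeasure_hausdorff_restr\<close> below shows that \<^const>\<open>measure_of\<close> does not degenerate here.
\<close>

definition hausdorff_restr :: "real \<Rightarrow> 'a::metric_space set \<Rightarrow> 'a measure" where
  "hausdorff_restr s E = measure_of UNIV (sets borel) (\<lambda>A. hausdorff_measure s (E \<inter> A))"


section \<open>The restriction is a Borel measure\<close>

lemma diam_pow_mono: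
  assumes "U \<subseteq> V" "bounded V" "0 \<le> s"
  shows "diam_pow s U \<le> diam_pow s V"
proof -
  have "diameter U powr s \<le> diameter V powr s"
    using assms diameter_subset[of U V] diameter_ge_0[of U] bounded_subset[of V U]
    by (intro powr_mono2) auto
  then show ?thesis using assms by (auto simp: diam_pow_def intro!: ennreal_leI)
qed

lemma hausdorff_content_mono:
  assumes "A \<subseteq> B" shows "hausdorff_content s \<delta> A \<le> hausdorff_content s \<delta> B"
  unfolding hausdorff_content_def
  by (rule INF_superset_mono) (use assms in \<open>auto simp: hausdorff_covers_def\<close>)

lemma hausdorff_content_antimono:
  assumes "\<delta> \<le> \<delta>'" shows "hausdorff_content s \<delta>' A \<le> hausdorff_content s \<delta> A"
  unfolding hausdorff_content_def
  by (rule INF_superset_mono) (use assms in \<open>auto simp: hausdorff_covers_def intro: order_trans\<close>)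

lemma hausdorff_content_empty:
  assumes "0 < \<delta>" shows "hausdorff_content s \<delta> ({} :: 'a::metric_space set) = 0"
proof -
  have "(\<lambda>_. {}) \<in> hausdorff_covers \<delta> ({} :: 'a set)" using assms by (auto simp: hausdorff_covers_def)
  then have "hausdorff_content s \<delta> ({} :: 'a set) \<le> (\<Sum>i::nat. diam_pow s ({}::'a set))"
    unfolding hausdorff_content_def by (rule INF_lower2) simp
  then show ?thesis by (simp add: diam_pow_def)
qed

lemma hausdorff_content_UN:
  "hausdorff_content s \<delta> (\<Union>i. A i) \<le> (\<Sum>i::nat. hausdorff_content s \<delta> (A i))"
proof (rule ennreal_le_epsilon)
  fix e :: real assume fin: "(\<Sum>i. hausdorff_content s \<delta> (A i)) < top" and e: "0 < e"
  have fin1: "hausdorff_content s \<delta> (A i) < top" for i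
    using fin by (rule ennreal_suminf_lessD)
  have "\<exists>U\<in>hausdorff_covers \<delta> (A i).
      (\<Sum>j. diam_pow s (U j)) < hausdorff_content s \<delta> (A i) + ennreal (e * (1/2)^Suc i)" for i
  proof -
    have "hausdorff_content s \<delta> (A i) < hausdorff_content s \<delta> (A i) + ennreal (e * (1/2)^Suc i)"
      using fin1[of i] e by (simp add: ennreal_add_left_cancel_less)
    then show ?thesis unfolding hausdorff_content_def INF_less_iff .
  qed
  then obtain U where U: "\<And>i. U i \<in> hausdorff_covers \<delta> (A i)"
    and le: "\<And>i. (\<Sum>j. diam_pow s (U i j)) < hausdorff_content s \<delta> (A i) + ennreal (e * (1/2)^Suc i)"
    by metis
  define W where "W = (\<lambda>n. case_prod U (prod_decode n))"
  have "W \<in> hausdorff_covers \<delta> (\<Union>i. A i)"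
    unfolding hausdorff_covers_def
  proof (intro CollectI conjI allI subsetI)
    fix x assume "x \<in> (\<Union>i. A i)"
    then obtain i j where "x \<in> U i j" using U unfolding hausdorff_covers_def by blast
    then have "x \<in> W (prod_encode (i, j))" by (simp add: W_def)
    then show "x \<in> (\<Union>n. W n)" by blast
  qed (use U in \<open>auto simp: W_def hausdorff_covers_def split: prod.splits\<close>)
  then have "hausdorff_content s \<delta> (\<Union>i. A i) \<le> (\<Sum>n. diam_pow s (W n))"
    unfolding hausdorff_content_def by (rule INF_lower)
  also have "\<dots> = (\<Sum>n. (\<lambda>(i, j). diam_pow s (U i j)) (prod_decode n))"
    by (simp add: W_def case_prod_beta)
  also have "\<dots> = (\<Sum>i. \<Sum>j. diam_pow s (U i j))"
    by (rule suminf_ennreal_2dimen) simp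
  also have "\<dots> \<le> (\<Sum>i. hausdorff_content s \<delta> (A i) + ennreal (e * (1/2)^Suc i))"
    using le by (intro suminf_le) (auto intro: less_imp_le)
  also have "\<dots> = (\<Sum>i. hausdorff_content s \<delta> (A i)) + (\<Sum>i. ennreal (e * (1/2)^Suc i))"
    by (subst suminf_add) auto
  also have "(\<Sum>i. ennreal (e * (1/2)^Suc i)) = ennreal e"
  proof (rule suminf_ennreal_eq)
    show "(\<lambda>i. e * (1/2)^Suc i) sums e" using sums_mult[OF power_half_series, of e] by simp
  qed (use e in auto)
  finally show "hausdorff_content s \<delta> (\<Union>i. A i) \<le> (\<Sum>i. hausdorff_content s \<delta> (A i)) + ennreal e" .
qed

lemma hausdorff_measure_mono: "A \<subseteq> B \<Longrightarrow> hausdorff_measure s A \<le> hausdorff_measure s B"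
  unfolding hausdorff_measure_def by (intro SUP_mono) (auto intro: hausdorff_content_mono)

lemma hausdorff_measure_empty [simp]: "hausdorff_measure s {} = 0"
proof -
  have "hausdorff_measure s {} \<le> 0"
    unfolding hausdorff_measure_def by (rule SUP_least) (simp add: hausdorff_content_empty)
  then show ?thesis by simp
qed

lemma hausdorff_measure_UN:
  "hausdorff_measure s (\<Union>i. A i) \<le> (\<Sum>i::nat. hausdorff_measure s (A i))"
  unfolding hausdorff_measure_def[of s "\<Union>i. A i"]
proof (rule SUP_least)
  fix \<delta> :: real assume "\<delta> \<in> {0<..}"
  then have "(\<Sum>i. hausdorff_content s \<delta> (A i)) \<le> (\<Sum>i. hausdorff_measure s (A i))"
    unfolding hausdorff_measure_def by (intro suminf_le SUP_upper) auto
  with hausdorff_content_UN[of s \<delta> A]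
  show "hausdorff_content s \<delta> (\<Union>i. A i) \<le> (\<Sum>i. hausdorff_measure s (A i))" by (rule order_trans)
qed

lemma hausdorff_content_separated:
  assumes s: "0 \<le> s" and \<delta>: "\<delta> < d" and sep: "\<And>x y. x \<in> A \<Longrightarrow> y \<in> B \<Longrightarrow> d \<le> dist x y"
  shows "hausdorff_content s \<delta> A + hausdorff_content s \<delta> B \<le> hausdorff_content s \<delta> (A \<union> B)"
  unfolding hausdorff_content_def[of s \<delta> "A \<union> B"]
proof (rule INF_greatest)
  fix U assume U: "U \<in> hausdorff_covers \<delta> (A \<union> B)"
  define V where "V = (\<lambda>C i. if U i \<inter> C = {} then {} else U i)"
  have cov: "V C \<in> hausdorff_covers \<delta> C" if "C \<subseteq> A \<union> B" for C
    unfolding hausdorff_covers_def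
  proof (intro CollectI conjI allI subsetI)
    fix x assume "x \<in> C"
    moreover have "A \<union> B \<subseteq> (\<Union>i. U i)" using U by (simp add: hausdorff_covers_def)
    ultimately have "x \<in> (\<Union>i. U i)" using that by blast
    then obtain i where "x \<in> U i" by blast
    with \<open>x \<in> C\<close> have "x \<in> V C i" by (auto simp: V_def)
    then show "x \<in> (\<Union>n. V C n)" by blast
  next
    fix i
    have "bounded (U i)" "diameter (U i) \<le> \<delta>" using U by (auto simp: hausdorff_covers_def)
    moreover from this have "0 \<le> \<delta>" using diameter_ge_0[of "U i"] by linarith
    ultimately show "bounded (V C i)" "diameter (V C i) \<le> \<delta>" by (auto simp: V_def)
  qed
  have "hausdorff_content s \<delta> A + hausdorff_content s \<delta> B
      \<le> (\<Sum>i. diam_pow s (V A i)) + (\<Sum>i. diam_pow s (V B i))"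
    unfolding hausdorff_content_def by (intro add_mono INF_lower cov) auto
  also have "\<dots> = (\<Sum>i. diam_pow s (V A i) + diam_pow s (V B i))"
    by (subst suminf_add) auto
  also have "\<dots> \<le> (\<Sum>i. diam_pow s (U i))"
  proof (intro suminf_le allI)
    fix i
    have "U i \<inter> A = {} \<or> U i \<inter> B = {}"
    proof (rule ccontr)
      assume "\<not> ?thesis"
      then obtain x y where xy: "x \<in> U i" "x \<in> A" "y \<in> U i" "y \<in> B" by blast
      then have "dist x y \<le> diameter (U i)"
        using U by (intro diameter_bounded_bound) (auto simp: hausdorff_covers_def)
      moreover have "diameter (U i) \<le> \<delta>" using U by (auto simp: hausdorff_covers_def)
      ultimately show False using sep[of x y] xy \<delta> by linarith
    qed
    then show "diam_pow s (V A i) + diam_pow s (V B i) \<le> diam_pow s (U i)"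
      by (auto simp: V_def diam_pow_def)
  qed auto
  finally show "hausdorff_content s \<delta> A + hausdorff_content s \<delta> B \<le> (\<Sum>i. diam_pow s (U i))" .
qed

lemma hausdorff_measure_separated:
  assumes s: "0 \<le> s" and d: "0 < d" and sep: "\<And>x y. x \<in> A \<Longrightarrow> y \<in> B \<Longrightarrow> d \<le> dist x y"
  shows "hausdorff_measure s A + hausdorff_measure s B \<le> hausdorff_measure s (A \<union> B)"
proof -
  have "hausdorff_measure s A + hausdorff_measure s B
      = (SUP \<delta>\<in>{0<..}. hausdorff_content s \<delta> A + hausdorff_content s \<delta> B)"
    unfolding hausdorff_measure_def
  proof (rule SUP_add_directed_ennreal[symmetric])
    fix i j :: real assume "i \<in> {0<..}" "j \<in> {0<..}"
    then show "\<exists>k\<in>{0<..}. hausdorff_content s i A + hausdorff_content s j B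
        \<le> hausdorff_content s k A + hausdorff_content s k B"
      by (intro bexI[of _ "min i j"] add_mono hausdorff_content_antimono) auto
  qed
  also have "\<dots> \<le> hausdorff_measure s (A \<union> B)"
  proof (rule SUP_least)
    fix \<delta> :: real assume \<delta>: "\<delta> \<in> {0<..}"
    define k where "k = min \<delta> (d / 2)"
    have k: "0 < k" "k \<le> \<delta>" "k < d" using \<delta> d by (auto simp: k_def)
    have "hausdorff_content s \<delta> A + hausdorff_content s \<delta> B
        \<le> hausdorff_content s k A + hausdorff_content s k B"
      using k by (intro add_mono hausdorff_content_antimono)
    also have "\<dots> \<le> hausdorff_content s k (A \<union> B)"
      using hausdorff_content_separated[OF s k(3) sep] .
    also have "\<dots> \<le> hausdorff_measure s (A \<union> B)"
      unfolding hausdorff_measure_def using k by (intro SUP_upper) auto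
    finally show "hausdorff_content s \<delta> A + hausdorff_content s \<delta> B \<le> hausdorff_measure s (A \<union> B)" .
  qed
  finally show ?thesis .
qed

lemma hausdorff_measure_Un: "hausdorff_measure s (A \<union> B) \<le> hausdorff_measure s A + hausdorff_measure s B"
proof -
  define D where "D = (\<lambda>i::nat. if i = 0 then A else if i = 1 then B else {})"
  have D: "D 0 = A" "D 1 = B" "\<And>i. i \<notin> {0, 1} \<Longrightarrow> D i = {}" by (auto simp: D_def)
  have "A \<union> B \<subseteq> (\<Union>i. D i)" using D(1,2) by blast
  then have "hausdorff_measure s (A \<union> B) \<le> hausdorff_measure s (\<Union>i. D i)"
    by (rule hausdorff_measure_mono)
  also have "\<dots> \<le> (\<Sum>i. hausdorff_measure s (D i))"
    by (rule hausdorff_measure_UN)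
  also have "\<dots> = (\<Sum>i\<in>{0, 1}. hausdorff_measure s (D i))"
    by (rule suminf_finite) (use D in simp_all)
  finally show ?thesis using D by simp
qed

lemma hausdorff_measure_chain:
  fixes B :: "nat \<Rightarrow> 'a::metric_space set"
  assumes s: "0 \<le> s"
    and sep: "\<And>k l. k + 2 \<le> l \<Longrightarrow> \<exists>d>0. \<forall>x\<in>B k. \<forall>y\<in>B l. d \<le> dist x y"
  shows "(\<Sum>k<n. hausdorff_measure s (B (2 * k + p))) \<le> hausdorff_measure s (\<Union>k<n. B (2 * k + p))"
proof (induction n)
  case (Suc n)
  have "\<exists>d>0. \<forall>x\<in>(\<Union>k<m. B (2 * k + p)). \<forall>y\<in>B (2 * n + p). d \<le> dist x y" if "m \<le> n" for m
    using that
  proof (induction m)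
    case 0 then show ?case by (auto intro: exI[of _ 1])
  next
    case (Suc m)
    then obtain d where d: "d > 0" "\<forall>x\<in>(\<Union>k<m. B (2 * k + p)). \<forall>y\<in>B (2 * n + p). d \<le> dist x y"
      by auto
    obtain d' where d': "d' > 0" "\<forall>x\<in>B (2 * m + p). \<forall>y\<in>B (2 * n + p). d' \<le> dist x y"
      using sep[of "2 * m + p" "2 * n + p"] Suc.prems by auto
    show ?case
      by (rule exI[of _ "min d d'"]) (use d d' in \<open>force simp: lessThan_Suc min_le_iff_disj\<close>)
  qed
  then obtain d where d: "d > 0" "\<forall>x\<in>(\<Union>k<n. B (2 * k + p)). \<forall>y\<in>B (2 * n + p). d \<le> dist x y"
    by blast
  have "(\<Sum>k<Suc n. hausdorff_measure s (B (2 * k + p)))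
      \<le> hausdorff_measure s (\<Union>k<n. B (2 * k + p)) + hausdorff_measure s (B (2 * n + p))"
    using Suc.IH by (simp add: add_right_mono)
  also have "\<dots> \<le> hausdorff_measure s ((\<Union>k<n. B (2 * k + p)) \<union> B (2 * n + p))"
    using d by (intro hausdorff_measure_separated[OF s]) auto
  also have "(\<Union>k<n. B (2 * k + p)) \<union> B (2 * n + p) = (\<Union>k<Suc n. B (2 * k + p))"
    by (auto simp: lessThan_Suc)
  finally show ?case .
qed simp

lemma hausdorff_measure_closed_split:
  fixes C X :: "'a::metric_space set"
  assumes s: "0 \<le> s" and C: "closed C"
  shows "hausdorff_measure s (X \<inter> C) + hausdorff_measure s (X - C) \<le> hausdorff_measure s X"
proof (cases "C = {} \<or> hausdorff_measure s X = top")
  case True then show ?thesis by auto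
next
  case False
  then have ne: "C \<noteq> {}" and fin: "hausdorff_measure s X < top" by (auto simp: top.not_eq_extremum)
  define r where "r = (\<lambda>n::nat. 1 / real (Suc n))"
  have r0: "0 < r n" for n by (simp add: r_def)
  have rmono: "r n \<le> r m" if "m \<le> n" for m n using that by (simp add: r_def frac_le)
  have rless: "r n < r m" if "m < n" for m n using that by (simp add: r_def frac_less2)
  define A where "A = (\<lambda>n. {x\<in>X. r n \<le> infdist x C})"
  define B where "B = (\<lambda>n. A (Suc n) - A n)"
  have sepB: "\<exists>d>0. \<forall>x\<in>B k. \<forall>y\<in>B l. d \<le> dist x y" if "k + 2 \<le> l" for k l
  proof (intro exI[of _ "r (Suc k) - r l"] conjI ballI)
    show "0 < r (Suc k) - r l" using rless[of "Suc k" l] that by simp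
    fix x y assume "x \<in> B k" "y \<in> B l"
    then have "r (Suc k) \<le> infdist x C" "infdist y C < r l" by (auto simp: A_def B_def)
    then show "r (Suc k) - r l \<le> dist x y" using infdist_triangle[of x C y] by linarith
  qed
  have sub: "(\<Union>k<n. B (2 * k + p)) \<subseteq> X" for n p by (auto simp: B_def A_def)
  have half: "(\<Sum>k. hausdorff_measure s (B (2 * k + p))) \<le> hausdorff_measure s X" for p
  proof (rule suminf_le_const[OF summableI])
    fix n
    have "(\<Sum>k<n. hausdorff_measure s (B (2 * k + p))) \<le> hausdorff_measure s (\<Union>k<n. B (2 * k + p))"
      by (rule hausdorff_measure_chain[OF s sepB])
    also have "\<dots> \<le> hausdorff_measure s X" by (rule hausdorff_measure_mono[OF sub])
    finally show "(\<Sum>k<n. hausdorff_measure s (B (2 * k + p))) \<le> hausdorff_measure s X" .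
  qed
  have tot: "(\<Sum>k<n. hausdorff_measure s (B k)) \<le> hausdorff_measure s X + hausdorff_measure s X" for n
  proof -
    have "(\<Sum>k<n. hausdorff_measure s (B k)) \<le> (\<Sum>k<2*n. hausdorff_measure s (B k))"
      by (rule sum_mono2) auto
    also have "\<dots> = (\<Sum>k<n. hausdorff_measure s (B (2 * k + 0))) + (\<Sum>k<n. hausdorff_measure s (B (2 * k + 1)))"
      by (induction n) (auto simp: ac_simps)
    also have "\<dots> \<le> hausdorff_measure s X + hausdorff_measure s X"
      by (intro add_mono order_trans[OF sum_le_suminf half] summableI) auto
    finally show ?thesis .
  qed
  then have "(\<Sum>k. hausdorff_measure s (B k)) \<le> hausdorff_measure s X + hausdorff_measure s X"
    by (intro suminf_le_const summableI)
  then have sfin: "(\<Sum>k. hausdorff_measure s (B k)) < top"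
    using fin by (auto intro: le_less_trans)
  have bound: "hausdorff_measure s (X \<inter> C) + hausdorff_measure s (X - C)
      \<le> hausdorff_measure s X + (\<Sum>k. hausdorff_measure s (B (k + n)))" for n
  proof -
    have "X - C \<subseteq> A n \<union> (\<Union>k. B (k + n))"
    proof
      fix x assume x: "x \<in> X - C"
      then have "0 < infdist x C" using infdist_pos_not_in_closed[OF C ne] by auto
      then obtain m0 where m0: "r m0 < infdist x C"
        using reals_Archimedean[of "infdist x C"] by (auto simp: r_def field_simps)
      then have ex: "\<exists>m. x \<in> A m" using x by (auto simp: A_def intro: less_imp_le)
      define m where "m = (LEAST m. x \<in> A m)"
      have m: "x \<in> A m" using LeastI_ex[OF ex] by (simp add: m_def)
      show "x \<in> A n \<union> (\<Union>k. B (k + n))"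
      proof (cases "m \<le> n")
        case True
        then have "x \<in> A n" using m rmono[OF True] by (auto simp: A_def)
        then show ?thesis by simp
      next
        case False
        then obtain q where q: "m = Suc (q + n)" by (metis add.commute less_imp_Suc_add not_le)
        then have "x \<notin> A (q + n)" unfolding m_def using not_less_Least by (metis lessI)
        then have "x \<in> B (q + n)" using m q by (auto simp: B_def)
        then show ?thesis by blast
      qed
    qed
    then have "hausdorff_measure s (X - C) \<le> hausdorff_measure s (A n \<union> (\<Union>k. B (k + n)))"
      by (rule hausdorff_measure_mono)
    also have "\<dots> \<le> hausdorff_measure s (A n) + hausdorff_measure s (\<Union>k. B (k + n))"
      by (rule hausdorff_measure_Un)
    also have "\<dots> \<le> hausdorff_measure s (A n) + (\<Sum>k. hausdorff_measure s (B (k + n)))"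
      by (intro add_left_mono hausdorff_measure_UN)
    finally have "hausdorff_measure s (X \<inter> C) + hausdorff_measure s (X - C)
        \<le> hausdorff_measure s (X \<inter> C) + hausdorff_measure s (A n) + (\<Sum>k. hausdorff_measure s (B (k + n)))"
      by (simp add: add.assoc add_left_mono)
    also have "hausdorff_measure s (X \<inter> C) + hausdorff_measure s (A n)
        \<le> hausdorff_measure s ((X \<inter> C) \<union> A n)"
    proof (rule hausdorff_measure_separated[OF s r0])
      fix x y assume "x \<in> X \<inter> C" "y \<in> A n"
      then show "r n \<le> dist x y" using infdist_le[of x C y] by (auto simp: A_def dist_commute)
    qed
    also have "hausdorff_measure s ((X \<inter> C) \<union> A n) \<le> hausdorff_measure s X"
      by (rule hausdorff_measure_mono) (auto simp: A_def)
    finally show ?thesis by (simp add: add_right_mono)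
  qed
  define f where "f = (\<lambda>k. enn2real (hausdorff_measure s (B k)))"
  have fB: "hausdorff_measure s (B k) = ennreal (f k)" for k
    unfolding f_def using ennreal_suminf_lessD[OF sfin, of k] by (simp add: less_top)
  have f0: "0 \<le> f k" for k by (simp add: f_def)
  have sf: "summable f"
    using sfin f0 by (intro summable_suminf_not_top) (auto simp: fB)
  have "(\<lambda>n. \<Sum>k. f (k + n)) \<longlonglongrightarrow> 0" by (rule suminf_exist_split2[OF sf])
  then have "(\<lambda>n. ennreal (\<Sum>k. f (k + n))) \<longlonglongrightarrow> ennreal 0" by (rule tendsto_ennrealI)
  moreover have "(\<Sum>k. hausdorff_measure s (B (k + n))) = ennreal (\<Sum>k. f (k + n))" for n
    unfolding fB using f0 sf by (intro suminf_ennreal2) (auto simp: summable_iff_shift)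
  ultimately have "(\<lambda>n. \<Sum>k. hausdorff_measure s (B (k + n))) \<longlonglongrightarrow> 0" by simp
  then have "(\<lambda>n. hausdorff_measure s X + (\<Sum>k. hausdorff_measure s (B (k + n))))
      \<longlonglongrightarrow> hausdorff_measure s X + 0"
    by (intro tendsto_add tendsto_const)
  then show ?thesis
    using bound by (auto intro: LIMSEQ_le_const)
qed

lemma measure_space_hausdorff:
  fixes E :: "'a::metric_space set"
  assumes s: "0 \<le> s"
  shows "measure_space UNIV (sets borel) (\<lambda>A. hausdorff_measure s (E \<inter> A))" (is "measure_space _ _ ?f")
proof -
  have oms: "outer_measure_space (Pow UNIV) ?f"
    unfolding outer_measure_space_def
  proof (intro conjI)
    show "positive (Pow UNIV) ?f" by (simp add: positive_def)
    show "increasing (Pow UNIV) ?f"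
      by (auto simp: increasing_def intro!: hausdorff_measure_mono)
    show "countably_subadditive (Pow UNIV) ?f"
      unfolding countably_subadditive_def
    proof (intro allI impI)
      fix A :: "nat \<Rightarrow> 'a set"
      show "?f (\<Union>i. A i) \<le> (\<Sum>i. ?f (A i))"
        using hausdorff_measure_UN[of s "\<lambda>i. E \<inter> A i"] by simp
    qed
  qed
  let ?L = "lambda_system UNIV (Pow UNIV) ?f"
  have L: "measure_space UNIV ?L ?f"
    using sigma_algebra.caratheodory_lemma[OF sigma_algebra_Pow oms] .
  then have sa: "sigma_algebra UNIV ?L" by (simp add: measure_space_def)
  have "Collect closed \<subseteq> ?L"
  proof
    fix C :: "'a set" assume "C \<in> Collect closed"
    then have C: "closed C" by simp
    have "?f (C \<inter> X) + ?f ((UNIV - C) \<inter> X) = ?f X" for X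
    proof (rule antisym)
      have eq: "E \<inter> (C \<inter> X) = (E \<inter> X) \<inter> C" "E \<inter> ((UNIV - C) \<inter> X) = (E \<inter> X) - C" by auto
      show "?f (C \<inter> X) + ?f ((UNIV - C) \<inter> X) \<le> ?f X"
        unfolding eq by (rule hausdorff_measure_closed_split[OF s C])
      have "E \<inter> X = (E \<inter> X) \<inter> C \<union> ((E \<inter> X) - C)" by auto
      then show "?f X \<le> ?f (C \<inter> X) + ?f ((UNIV - C) \<inter> X)"
        unfolding eq using hausdorff_measure_Un[of s "(E \<inter> X) \<inter> C" "(E \<inter> X) - C"] by simp
    qed
    then show "C \<in> ?L" by (auto simp: lambda_system_def)
  qed
  then have "sigma_sets UNIV (Collect closed) \<subseteq> ?L"
    by (rule sigma_algebra.sigma_sets_subset[OF sa])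
  then have sub: "sets borel \<subseteq> ?L"
    unfolding borel_eq_closed by simp
  have "sigma_algebra UNIV (sets (borel::'a measure))"
    using sets.sigma_algebra_axioms[of "borel::'a measure"] by simp
  moreover have "positive (sets borel) ?f" by (simp add: positive_def)
  moreover have "countably_additive (sets borel) ?f"
  proof (rule countably_additiveI)
    fix A :: "nat \<Rightarrow> 'a set"
    assume A: "range A \<subseteq> sets borel" "disjoint_family A" "(\<Union>i. A i) \<in> sets borel"
    have "range A \<subseteq> ?L" "(\<Union>i. A i) \<in> ?L" using A sub by blast+
    moreover have "countably_additive ?L ?f" using L by (simp only: measure_space_def)
    ultimately show "(\<Sum>i. ?f (A i)) = ?f (\<Union>i. A i)"
      unfolding countably_additive_def using A(2) by blast
  qed
  ultimately show ?thesis by (simp add: measure_space_def)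
qed

lemma sets_hausdorff_restr [simp, measurable_cong]: "sets (hausdorff_restr s E) = sets borel"
  unfolding hausdorff_restr_def
  using sets.sigma_sets_eq[of "borel :: 'a::metric_space measure"] by (simp add: sets_measure_of)

lemma space_hausdorff_restr [simp]: "space (hausdorff_restr s E) = UNIV"
  by (simp add: hausdorff_restr_def space_measure_of_conv)

lemma emeasure_hausdorff_restr:
  assumes "0 \<le> s" "A \<in> sets borel"
  shows "emeasure (hausdorff_restr s E) A = hausdorff_measure s (E \<inter> A)"
proof -
  have ms: "measure_space UNIV (sets borel) (\<lambda>A. hausdorff_measure s (E \<inter> A))"
    using assms(1) by (rule measure_space_hausdorff)
  show ?thesis
    by (rule emeasure_measure_of[OF hausdorff_restr_def])
       (use ms assms(2) in \<open>auto simp: measure_space_def\<close>)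
qed


section \<open>Truncated Riesz transforms\<close>

definition riesz_truncated :: "real \<Rightarrow> (real^'m) measure \<Rightarrow> real \<Rightarrow> real^'m \<Rightarrow> real^'m" where
  "riesz_truncated s \<mu> \<epsilon> x =
     (LINT y:{y. norm (x - y) > \<epsilon>}|\<mu>. (1 / norm (x - y) powr (s + 1)) *\<^sub>R (x - y))"

text \<open>The integrand is genuinely integrable, so the value above is not the default value \<open>0\<close>.\<close>

lemma riesz_truncated_integrable:
  fixes E :: "(real^'m) set"
  assumes s: "0 \<le> s" and fin: "hausdorff_measure s E < \<infinity>" and \<epsilon>: "0 < \<epsilon>"
  shows "set_integrable (hausdorff_restr s E) {y. norm (x - y) > \<epsilon>}
           (\<lambda>y. (1 / norm (x - y) powr (s + 1)) *\<^sub>R (x - y))"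
  unfolding set_integrable_def
proof (rule finite_measure.integrable_const_bound[where B = "1 / \<epsilon> powr s"])
  show "finite_measure (hausdorff_restr s E)"
    by (rule finite_measureI) (use s fin in \<open>auto simp: emeasure_hausdorff_restr\<close>)
  have [measurable]: "{y. norm (x - y) > \<epsilon>} \<in> sets borel"
    by (intro borel_open open_Collect_less continuous_intros)
  show "(\<lambda>y. indicat_real {y. norm (x - y) > \<epsilon>} y *\<^sub>R (1 / norm (x - y) powr (s + 1)) *\<^sub>R (x - y))
      \<in> borel_measurable (hausdorff_restr s E)"
    by measurable
  have "norm (indicat_real {y. norm (x - y) > \<epsilon>} y *\<^sub>R (1 / norm (x - y) powr (s + 1)) *\<^sub>R (x - y))
      \<le> 1 / \<epsilon> powr s" for y
  proof (cases "norm (x - y) > \<epsilon>")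
    case True
    then have pos: "0 < norm (x - y)" using \<epsilon> by linarith
    have "norm (x - y) / norm (x - y) powr (s + 1) = 1 / norm (x - y) powr s"
      using pos by (simp add: powr_add)
    also have "\<dots> \<le> 1 / \<epsilon> powr s"
      using True \<epsilon> s pos by (intro divide_left_mono powr_mono2 mult_pos_pos) auto
    finally show ?thesis using True by simp
  qed simp
  then show "AE y in hausdorff_restr s E.
      norm (indicat_real {y. norm (x - y) > \<epsilon>} y *\<^sub>R (1 / norm (x - y) powr (s + 1)) *\<^sub>R (x - y))
      \<le> 1 / \<epsilon> powr s"
    by simp
qed

end

theory Submission
  imports Defs
begin

text \<open>
  Let \<open>\<mu>\<close> be the restricted measure and suppose \<open>k - 1 < s < k\<close> with \<open>k\<close> an integer. Averaging the
  truncated integrals over the truncation radius against the weight \<open>\<phi>(z) = (1 - |z|\<^sup>2/R\<^sup>2)\<^sub>+\<^sup>2\<close>, the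
  existence of principal values makes the field \<open>V(x) = \<integral> \<phi>(x - y) (x - y) d\<mu>(y)\<close> negligible at every
  point of a set \<open>F\<close> of positive measure on which \<open>\<mu>\<close> has uniform growth \<open>r\<^sup>s\<close>. Expanding \<open>V\<close> to first order
  around \<open>x\<^sub>0 \<in> F\<close> at a scale \<open>R\<close> much larger than \<open>r\<close>, the symmetric operator
  \<open>DV(x\<^sub>0) = A Id - Q\<close>, with \<open>A = \<integral> \<phi>(x\<^sub>0 - y) d\<mu>(y)\<close> and \<open>Q\<close> positive semidefinite, almost
  annihilates \<open>x - x\<^sub>0\<close> for all \<open>x \<in> F\<close> with \<open>|x - x\<^sub>0| \<le> r\<close>. If \<open>r\<close> is a scale of positive upper density,
  the growth \<open>r\<^sup>s\<close> with \<open>s > k - 1\<close> prevents these vectors from clustering near a subspace of dimension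
  less than \<open>k\<close>, so \<open>tr Q\<close> is almost at least \<open>k A\<close>. On the other hand \<open>tr Q = R dA/dR\<close>, and
  \<open>A = O(R\<^sup>s)\<close> allows one to choose \<open>R\<close> comparable to \<open>r\<close> with \<open>R dA/dR \<le> q A\<close> for some \<open>q < k\<close>.
\<close>

section \<open>Densities of the Hausdorff measure\<close>

lemma hausdorff_measure_null_Un:
  "hausdorff_measure s A = 0 \<Longrightarrow> hausdorff_measure s (A \<union> B) = hausdorff_measure s B"
  using hausdorff_measure_Un[of s A B] hausdorff_measure_mono[of B "A \<union> B" s] by auto

lemma hausdorff_measure_null_UN:
  assumes "\<And>i::nat. hausdorff_measure s (A i) = 0"
  shows "hausdorff_measure s (\<Union>i. A i) = 0"
  using hausdorff_measure_UN[of s A] assms by simp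

lemma hausdorff_measure_UN_finite:
  assumes "finite I"
  shows "hausdorff_measure s (\<Union>i\<in>I. A i) \<le> (\<Sum>i\<in>I. hausdorff_measure s (A i))"
  using assms
proof (induction I rule: finite_induct)
  case (insert x I)
  have "hausdorff_measure s (\<Union>i\<in>insert x I. A i)
      \<le> hausdorff_measure s (A x) + hausdorff_measure s (\<Union>i\<in>I. A i)"
    using hausdorff_measure_Un by auto
  also have "\<dots> \<le> hausdorff_measure s (A x) + (\<Sum>i\<in>I. hausdorff_measure s (A i))"
    using insert.IH by (rule add_left_mono)
  finally show ?case using insert by simp
qed auto

text \<open>A set \<open>U\<close> meeting \<open>G\<close> at \<open>x\<close> lies in
  \<open>cball x (diameter U)\<close>, so its share of \<open>G\<close> is at most half of
  \<open>diam_pow s U\<close>. Summing over fine covers bounds twice the measure of \<open>G\<close>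
  by the measure itself, which is finite. Any constant below 1 would serve in place of 1/2.\<close>

lemma hausdorff_null_of_small_density:
  fixes F :: "'a::metric_space set"
  assumes s: "0 < s" and fin: "hausdorff_measure s F < top" and \<rho>: "0 < \<rho>" and G: "G \<subseteq> F"
    and dens: "\<And>x r. x \<in> G \<Longrightarrow> 0 < r \<Longrightarrow> r < \<rho> \<Longrightarrow>
      hausdorff_measure s (F \<inter> cball x r) \<le> ennreal (r powr s / 2)"
  shows "hausdorff_measure s G = 0"
proof -
  define \<delta> where "\<delta> = \<rho> / 2"
  have \<delta>: "0 < \<delta>" "\<delta> < \<rho>" using \<rho> by (auto simp: \<delta>_def)
  have piece: "hausdorff_measure s (G \<inter> U) \<le> diam_pow s U / 2"
    if U: "bounded U" "diameter U \<le> \<delta>" for U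
  proof (cases "G \<inter> U = {}")
    case False
    then obtain x where x: "x \<in> G" "x \<in> U" by auto
    have sub: "U \<subseteq> cball x (diameter U)"
      using U x by (auto intro: diameter_bounded_bound)
    have le: "hausdorff_measure s (G \<inter> U) \<le> ennreal (r powr s / 2)"
      if "0 < r" "r < \<rho>" "diameter U \<le> r" for r
    proof -
      have "hausdorff_measure s (G \<inter> U) \<le> hausdorff_measure s (F \<inter> cball x r)"
        using sub G that by (intro hausdorff_measure_mono) force
      then show ?thesis using dens[OF x(1) that(1,2)] by (rule order_trans)
    qed
    show ?thesis
    proof (cases "diameter U = 0")
      \<comment> \<open>The density bound is assumed at positive radii only. A one-point
        \<open>U\<close> is treated by letting the radius tend to 0, where s > 0 makes
        \<open>r powr s\<close> vanish.\<close>
      case True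
      have "((\<lambda>r. ennreal (r powr s / 2)) \<longlongrightarrow> ennreal (0 powr s / 2)) (at_right 0)"
        using s by (intro tendsto_ennrealI tendsto_intros tendsto_powr2)
           (auto simp: eventually_at_filter)
      moreover have "eventually (\<lambda>r. hausdorff_measure s (G \<inter> U) \<le> ennreal (r powr s / 2)) (at_right 0)"
        unfolding eventually_at_right_field using \<rho> le True by (intro exI[of _ \<rho>]) auto
      ultimately have "hausdorff_measure s (G \<inter> U) \<le> ennreal (0 powr s / 2)"
        by (rule tendsto_lowerbound) simp
      then show ?thesis by simp
    next
      case False
      then have "0 < diameter U" using diameter_ge_0[OF U(1)] by simp
      then have "hausdorff_measure s (G \<inter> U) \<le> ennreal (diameter U powr s / 2)"
        using le[of "diameter U"] U \<delta> by auto
      also have "\<dots> = diam_pow s U / 2"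
        using x s by (auto simp: diam_pow_def ennreal_divide_numeral)
      finally show ?thesis .
    qed
  qed simp
  have "2 * hausdorff_measure s G \<le> hausdorff_content s \<delta> G"
    unfolding hausdorff_content_def
  proof (rule INF_greatest)
    fix U assume "U \<in> hausdorff_covers \<delta> G"
    then have cov: "G \<subseteq> (\<Union>i. U i)" and U: "\<And>i. bounded (U i) \<and> diameter (U i) \<le> \<delta>"
      by (auto simp: hausdorff_covers_def)
    have "hausdorff_measure s G = hausdorff_measure s (\<Union>i. G \<inter> U i)"
      using cov by (intro arg_cong[of _ _ "hausdorff_measure s"]) auto
    also have "\<dots> \<le> (\<Sum>i. hausdorff_measure s (G \<inter> U i))" by (rule hausdorff_measure_UN)
    also have "\<dots> \<le> (\<Sum>i. diam_pow s (U i) / 2)"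
      using piece U by (intro suminf_le) auto
    finally have "2 * hausdorff_measure s G \<le> 2 * (\<Sum>i. diam_pow s (U i) / 2)"
      by (rule mult_left_mono) simp
    also have "\<dots> = (\<Sum>i. 2 * (diam_pow s (U i) / 2))" by (rule ennreal_suminf_cmult[symmetric])
    also have "\<dots> = (\<Sum>i. diam_pow s (U i))"
      unfolding ennreal_times_divide mult.commute[of "2::ennreal"]
      by (subst mult_divide_eq_ennreal) auto
    finally show "2 * hausdorff_measure s G \<le> (\<Sum>i. diam_pow s (U i))" .
  qed
  also have "\<dots> \<le> hausdorff_measure s G"
    unfolding hausdorff_measure_def using \<delta> by (intro SUP_upper) auto
  finally have le: "2 * hausdorff_measure s G \<le> hausdorff_measure s G" .
  have "hausdorff_measure s G < top"
    using hausdorff_measure_mono[OF G, of s] fin by (rule le_less_trans)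
  with le show ?thesis
    by (cases "hausdorff_measure s G") (auto simp: ennreal_mult[symmetric] simp flip: ennreal_numeral)
qed

text \<open>If every point failed, \<open>F\<close> would be exhausted by countably many sets
  \<open>G n\<close> on which the density is small at all radii below 1 / (n + 1), and each of these
  is null.\<close>

lemma exists_upper_density_point:
  fixes F :: "'a::metric_space set"
  assumes s: "0 < s" and pos: "0 < hausdorff_measure s F" and fin: "hausdorff_measure s F < top"
  shows "\<exists>x\<in>F. \<forall>\<rho>>0. \<exists>r. 0 < r \<and> r < \<rho> \<and> ennreal (r powr s / 2) \<le> hausdorff_measure s (F \<inter> cball x r)"
proof (rule ccontr)
  assume "\<not> ?thesis"
  then have neg: "\<And>x. x \<in> F \<Longrightarrow> \<exists>\<rho>>0. \<forall>r. 0 < r \<longrightarrow> r < \<rho> \<longrightarrow>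
      hausdorff_measure s (F \<inter> cball x r) \<le> ennreal (r powr s / 2)"
    by (meson linorder_le_cases)
  define G where "G = (\<lambda>n::nat. {x\<in>F. \<forall>r. 0 < r \<longrightarrow> r < 1 / real (Suc n) \<longrightarrow>
      hausdorff_measure s (F \<inter> cball x r) \<le> ennreal (r powr s / 2)})"
  have "F \<subseteq> (\<Union>n. G n)"
  proof
    fix x assume x: "x \<in> F"
    from neg[OF x] obtain \<rho> where \<rho>: "\<rho> > 0" "\<And>r. 0 < r \<Longrightarrow> r < \<rho> \<Longrightarrow>
      hausdorff_measure s (F \<inter> cball x r) \<le> ennreal (r powr s / 2)" by blast
    obtain n where "1 / real (Suc n) < \<rho>" using reals_Archimedean[OF \<rho>(1)] by (auto simp: field_simps)
    then have "x \<in> G n" using x \<rho>(2) by (auto simp: G_def)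
    then show "x \<in> (\<Union>n. G n)" by blast
  qed
  moreover have "hausdorff_measure s (\<Union>n. G n) = 0"
  proof (rule hausdorff_measure_null_UN)
    fix n show "hausdorff_measure s (G n) = 0"
      by (rule hausdorff_null_of_small_density[OF s fin, of "1 / real (Suc n)"]) (auto simp: G_def)
  qed
  ultimately show False using hausdorff_measure_mono[of F "\<Union>n. G n" s] pos by simp
qed

section \<open>Finiteness of the upper density almost everywhere\<close>

lemma hausdorff_measure_null_of_content:
  assumes "\<And>\<delta> e. 0 < \<delta> \<Longrightarrow> 0 < e \<Longrightarrow> hausdorff_content s \<delta> D \<le> ennreal e"
  shows "hausdorff_measure s D = 0"
proof -
  have "hausdorff_content s \<delta> D = 0" if "0 < \<delta>" for \<delta>
    using assms[OF that] by (metis ennreal_0 ennreal_le_epsilon le_zero_eq add_0)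
  then show ?thesis unfolding hausdorff_measure_def by (simp add: SUP_eq_iff)
qed

text \<open>Vitali covering argument: balls of density above \<open>C\<close> around the exceptional
  points have a disjoint subfamily whose fivefold enlargements cover. Disjointness bounds the sum of
  the powers of their diameters by a multiple of the total mass divided by \<open>C\<close>, and
  \<open>C\<close> is arbitrary. All radii are included, so that growth bounds hold at every scale
  and not only in the limit.\<close>

lemma upper_density_finite_ae:
  fixes E :: "'a::euclidean_space set"
  assumes s: "0 < s" and fin: "hausdorff_measure s E < top"
  shows "hausdorff_measure s
    {x\<in>E. \<forall>C::real. \<exists>r>0. ennreal (C * r powr s) < hausdorff_measure s (E \<inter> cball x r)} = 0"
    (is "hausdorff_measure s ?D = 0")
proof (rule hausdorff_measure_null_of_content)
  define D where "D = ?D"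
  have DD: "\<exists>r>0. ennreal (C * r powr s) < hausdorff_measure s (E \<inter> cball x r)" if "x \<in> D" for x and C :: real
    using that unfolding D_def by simp
  fix \<delta> e :: real assume \<delta>: "0 < \<delta>" and e: "0 < e"
  define \<mu> where "\<mu> = hausdorff_restr s E"
  define M where "M = enn2real (hausdorff_measure s E)"
  have M: "hausdorff_measure s E = ennreal M" "0 \<le> M"
    using fin by (auto simp: M_def less_top)
  \<comment> \<open>The first entry brings the sum over the enlarged balls below \<open>e\<close>.
    The second forces, by finiteness of the mass, radii at most \<open>\<delta> / 10\<close>, so
    that the enlarged balls have diameter at most \<delta>.\<close>
  define C where "C = max ((10 powr s * M + 1) / e) ((M + 1) * (10 / \<delta>) powr s)"
  have "0 < (10 powr s * M + 1) / e" using M(2) e by (intro divide_pos_pos add_nonneg_pos mult_nonneg_nonneg) auto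
  then have C0: "0 < C" by (simp add: C_def less_max_iff_disj)
  have Ce: "10 powr s * M \<le> C * e"
  proof -
    have "(10 powr s * M + 1) / e \<le> C" by (simp add: C_def)
    then have "10 powr s * M + 1 \<le> C * e" using e by (simp add: field_simps)
    then show ?thesis by simp
  qed
  have CM: "M < C * (\<delta> / 10) powr s"
  proof -
    have "(M + 1) * (10 / \<delta>) powr s * (\<delta> / 10) powr s \<le> C * (\<delta> / 10) powr s"
      by (rule mult_right_mono) (auto simp: C_def)
    moreover have "(10 / \<delta>) powr s * (\<delta> / 10) powr s = 1"
      using \<delta> by (simp flip: powr_mult)
    ultimately show ?thesis by (simp add: mult.assoc)
  qed
  obtain \<rho> where \<rho>: "\<And>x. x \<in> D \<Longrightarrow> \<rho> x > 0"
    "\<And>x. x \<in> D \<Longrightarrow> ennreal (C * \<rho> x powr s) < hausdorff_measure s (E \<inter> cball x (\<rho> x))"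
    using DD[of _ C] by metis
  have small: "\<rho> x \<le> \<delta> / 10" if x: "x \<in> D" for x
  proof (rule ccontr)
    assume "\<not> ?thesis"
    then have "(\<delta> / 10) powr s \<le> \<rho> x powr s" using \<delta> s by (intro powr_mono2) auto
    then have "C * (\<delta> / 10) powr s \<le> C * \<rho> x powr s" using C0 by simp
    then have "ennreal M \<le> ennreal (C * \<rho> x powr s)" using CM by (intro ennreal_leI) linarith
    also have "\<dots> < hausdorff_measure s (E \<inter> cball x (\<rho> x))" by (rule \<rho>(2)[OF x])
    also have "\<dots> \<le> hausdorff_measure s E" by (rule hausdorff_measure_mono) auto
    finally show False using M by simp
  qed
  have cov0: "D \<subseteq> (\<Union>x\<in>D. cball x (\<rho> x))"
  proof
    fix x assume x: "x \<in> D"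
    then have "x \<in> cball x (\<rho> x)" using less_imp_le[OF \<rho>(1)[OF x]] by simp
    with x show "x \<in> (\<Union>x\<in>D. cball x (\<rho> x))" by (rule UN_I)
  qed
  have small': "0 < \<rho> x \<and> \<rho> x \<le> \<delta> / 10" if "x \<in> D" for x
    using \<rho>(1)[OF that] small[OF that] ..
  obtain K where K: "countable K" "K \<subseteq> D"
     "pairwise (\<lambda>i j. disjnt (cball i (\<rho> i)) (cball j (\<rho> j))) K"
     "D \<subseteq> (\<Union>i\<in>K. cball i (5 * \<rho> i))"
    by (rule Vitali_covering_lemma_cballs[where a = "\<lambda>x. x" and r = \<rho> and S = D and K = D, OF cov0 small'])
  define f where "f = from_nat_into K"
  show "hausdorff_content s \<delta> ?D \<le> ennreal e"
    unfolding D_def[symmetric]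
  proof (cases "K = {}")
    case True
    then have "D = {}" using K(4) by simp
    then show "hausdorff_content s \<delta> D \<le> ennreal e" by (simp add: hausdorff_content_empty[OF \<delta>])
  next
    case False
    define I where "I = to_nat_on K ` K"
    \<comment> \<open>\<open>K\<close> may be finite while covers are sequences; the remaining
      indices carry the empty set, for which \<open>diam_pow\<close> is 0.\<close>
    define U where "U = (\<lambda>n. if n \<in> I then cball (f n) (5 * \<rho> (f n)) else {})"
    have fI: "f n \<in> K" if "n \<in> I" for n using that K(1) False by (auto simp: f_def from_nat_into)
    have finj: "inj_on f I"
      unfolding f_def I_def using K(1) by (auto simp: inj_on_def)
    have "U \<in> hausdorff_covers \<delta> D"
      unfolding hausdorff_covers_def
    proof (intro CollectI conjI allI)
      have "(\<Union>i\<in>K. cball i (5 * \<rho> i)) \<subseteq> (\<Union>n. U n)"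
      proof
        fix y assume "y \<in> (\<Union>i\<in>K. cball i (5 * \<rho> i))"
        then obtain i where i: "i \<in> K" "y \<in> cball i (5 * \<rho> i)" by auto
        then have "y \<in> U (to_nat_on K i)" using K(1) by (auto simp: U_def f_def I_def)
        then show "y \<in> (\<Union>n. U n)" by blast
      qed
      with K(4) show "D \<subseteq> (\<Union>n. U n)" by blast
      fix n
      show "bounded (U n)" by (simp add: U_def)
      show "diameter (U n) \<le> \<delta>"
        using small[of "f n"] fI[of n] K(2) \<delta> \<rho>(1)[of "f n"] by (auto simp: U_def diameter_cball)
    qed
    then have "hausdorff_content s \<delta> D \<le> (\<Sum>n. diam_pow s (U n))"
      unfolding hausdorff_content_def by (rule INF_lower)
    also have "\<dots> \<le> (\<Sum>n. ennreal (10 powr s / C) * emeasure \<mu> (if n \<in> I then cball (f n) (\<rho> (f n)) else {}))"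
    proof (intro suminf_le allI)
      fix n
      show "diam_pow s (U n) \<le> ennreal (10 powr s / C) * emeasure \<mu> (if n \<in> I then cball (f n) (\<rho> (f n)) else {})"
      proof (cases "n \<in> I")
        case True
        then have x: "f n \<in> D" using fI K(2) by blast
        have "diam_pow s (U n) = ennreal ((10 * \<rho> (f n)) powr s)"
          using True s \<rho>(1)[OF x] by (simp add: diam_pow_def U_def diameter_cball)
        also have "\<dots> = ennreal (10 powr s / C) * ennreal (C * \<rho> (f n) powr s)"
          using C0 \<rho>(1)[OF x] by (simp add: powr_mult flip: ennreal_mult)
        also have "\<dots> \<le> ennreal (10 powr s / C) * hausdorff_measure s (E \<inter> cball (f n) (\<rho> (f n)))"
          by (intro mult_left_mono less_imp_le[OF \<rho>(2)[OF x]]) auto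
        finally show ?thesis using True s by (simp add: \<mu>_def emeasure_hausdorff_restr)
      qed (simp add: U_def diam_pow_def)
    qed auto
    also have "\<dots> = ennreal (10 powr s / C) * (\<Sum>n. emeasure \<mu> (if n \<in> I then cball (f n) (\<rho> (f n)) else {}))"
      by simp
    also have "\<dots> \<le> ennreal (10 powr s / C) * ennreal M"
    proof (rule mult_left_mono)
      have disj: "cball (f m) (\<rho> (f m)) \<inter> cball (f n) (\<rho> (f n)) = {}"
        if "m \<in> I" "n \<in> I" "m \<noteq> n" for m n
      proof -
        have "f m \<noteq> f n" using finj that by (simp add: inj_on_eq_iff)
        then show ?thesis using pairwiseD[OF K(3) fI[OF that(1)] fI[OF that(2)]] by (simp add: disjnt_def)
      qed
      have "(\<Sum>n. emeasure \<mu> (if n \<in> I then cball (f n) (\<rho> (f n)) else {}))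
          = emeasure \<mu> (\<Union>n. if n \<in> I then cball (f n) (\<rho> (f n)) else {})"
        using disj by (intro suminf_emeasure) (auto simp: \<mu>_def disjoint_family_on_def)
      also have "\<dots> \<le> emeasure \<mu> UNIV" by (rule emeasure_mono) (auto simp: \<mu>_def)
      also have "\<dots> = ennreal M" using s M by (simp add: \<mu>_def emeasure_hausdorff_restr)
      finally show "(\<Sum>n. emeasure \<mu> (if n \<in> I then cball (f n) (\<rho> (f n)) else {})) \<le> ennreal M" .
    qed simp
    also have "ennreal (10 powr s / C) * ennreal M = ennreal (10 powr s * M / C)"
      using C0 M by (simp flip: ennreal_mult)
    also have "\<dots> \<le> ennreal e" using Ce C0 by (intro ennreal_leI) (simp add: field_simps)
    finally show "hausdorff_content s \<delta> D \<le> ennreal e" .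
  qed
qed

section \<open>The truncated quadratic weight\<close>

text \<open>The weight \<phi> is the square of \<open>bump\<close>. As a function of u = |z|^2 / R^2
  that square has derivative \<open>- 2 * max 0 (1 - u)\<close>, a multiple of \<open>bump\<close>
  itself, so both powers occur side by side below.\<close>

definition bump :: "real \<Rightarrow> 'a::real_inner \<Rightarrow> real" where
  "bump R z = max 0 (1 - (norm z)\<^sup>2 / R\<^sup>2)"

lemma bump_nonneg: "0 \<le> bump R z"
  by (simp add: bump_def)

lemma bump_le_1: "bump R z \<le> 1"
  by (simp add: bump_def)

lemma bump_eq_0: "0 < R \<Longrightarrow> R \<le> norm z \<Longrightarrow> bump R z = 0"
  by (simp add: bump_def power_mono)

lemma bump_sq_le_1: "(bump R z)\<^sup>2 \<le> 1"
  using bump_nonneg[of R z] bump_le_1[of R z] by (simp add: power_le_one)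

lemma bump_mono: "0 < R \<Longrightarrow> R \<le> R' \<Longrightarrow> bump R z \<le> bump R' z"
  unfolding bump_def by (intro max.mono diff_left_mono divide_left_mono power_mono) auto

lemma bump_ge:
  assumes "0 < R" "norm z \<le> \<theta> * R"
  shows "1 - \<theta>\<^sup>2 \<le> bump R z"
proof -
  have "(norm z)\<^sup>2 \<le> (\<theta> * R)\<^sup>2" using assms by (intro power_mono) auto
  then have "(norm z)\<^sup>2 / R\<^sup>2 \<le> \<theta>\<^sup>2" using assms by (simp add: field_simps power_mult_distrib)
  then show ?thesis by (simp add: bump_def)
qed

lemma continuous_bump: "continuous_on UNIV (bump R :: 'a::real_inner \<Rightarrow> real)"
proof (cases "R = 0")
  case False then show ?thesis unfolding bump_def by (intro continuous_intros) auto
qed (simp add: bump_def)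

lemma borel_measurable_bump [measurable]:
  "bump R \<in> borel_measurable (borel :: 'a::euclidean_space measure)"
  by (rule borel_measurable_continuous_onI[OF continuous_bump])

lemma norm_bump_scaleR_le:
  assumes "0 < R" shows "norm ((bump R z)\<^sup>2 *\<^sub>R z) \<le> R"
proof (cases "norm z \<le> R")
  case True
  have "(bump R z)\<^sup>2 * norm z \<le> 1 * R"
    using True bump_sq_le_1[of R z] by (intro mult_mono) auto
  then show ?thesis by simp
qed (use assms bump_eq_0[of R z] in auto)

text \<open>The squared hinge is convex in its variable and its derivative is Lipschitz with
  constant 2. Convexity makes the first-order remainder nonnegative, and the Lipschitz bound keeps
  it below \<open>(v - u)\<^sup>2\<close>.\<close>

lemma hinge_sq_taylor:
  fixes u v :: real
  shows "\<bar>(max 0 (1 - v))\<^sup>2 - (max 0 (1 - u))\<^sup>2 + 2 * max 0 (1 - u) * (v - u)\<bar> \<le> (v - u)\<^sup>2"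
    and "0 \<le> (max 0 (1 - v))\<^sup>2 - (max 0 (1 - u))\<^sup>2 + 2 * max 0 (1 - u) * (v - u)"
proof -
  let ?g = "(max 0 (1 - v))\<^sup>2 - (max 0 (1 - u))\<^sup>2 + 2 * max 0 (1 - u) * (v - u)"
  have "0 \<le> ?g \<and> ?g \<le> (v - u)\<^sup>2"
  proof (cases "u \<le> 1")
    case u: True
    show ?thesis
    proof (cases "v \<le> 1")
      case True
      then have "?g = (v - u)\<^sup>2" using u by (simp add: max_def power2_eq_square algebra_simps)
      then show ?thesis by simp
    next
      case False
      then have g: "?g = (v - u)\<^sup>2 - (v - 1)\<^sup>2" using u by (simp add: max_def power2_eq_square algebra_simps)
      have "(v - 1)\<^sup>2 \<le> (v - u)\<^sup>2" using u False by (intro power_mono) auto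
      then show ?thesis using g by simp
    qed
  next
    case u: False
    show ?thesis
    proof (cases "v \<le> 1")
      case True
      have "(1 - v)\<^sup>2 \<le> (u - v)\<^sup>2" using u True by (intro power_mono) auto
      then show ?thesis using u True by (simp add: max_def power2_commute[of u v])
    next
      case False
      then show ?thesis using u by (simp add: max_def)
    qed
  qed
  then show "\<bar>?g\<bar> \<le> (v - u)\<^sup>2" "0 \<le> ?g" by auto
qed

text \<open>Dilation by \<open>l\<close> replaces u = |z|^2 / R^2 by u / l^2, so this is the
  tangent-line inequality of the convex squared hinge at u.\<close>

lemma bump_sq_dilate:
  assumes "0 < R" "1 < l"
  shows "2 * (1 - 1 / l\<^sup>2) * (bump R z * (norm z)\<^sup>2 / R\<^sup>2) \<le> (bump (l * R) z)\<^sup>2 - (bump R z)\<^sup>2"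
proof -
  define u where "u = (norm z)\<^sup>2 / R\<^sup>2"
  have "(norm z)\<^sup>2 / (l * R)\<^sup>2 = u / l\<^sup>2"
    unfolding u_def power_mult_distrib by (simp add: mult.commute)
  then have b: "bump (l * R) z = max 0 (1 - u / l\<^sup>2)" "bump R z = max 0 (1 - u)"
    unfolding bump_def by (simp_all only: u_def)
  have "0 \<le> (max 0 (1 - u / l\<^sup>2))\<^sup>2 - (max 0 (1 - u))\<^sup>2 + 2 * max 0 (1 - u) * (u / l\<^sup>2 - u)"
    by (rule hinge_sq_taylor)
  moreover have "2 * (1 - 1 / l\<^sup>2) * (bump R z * (norm z)\<^sup>2 / R\<^sup>2) = - 2 * max 0 (1 - u) * (u / l\<^sup>2 - u)"
    unfolding b unfolding u_def[symmetric] times_divide_eq_right[symmetric] by (simp add: algebra_simps)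
  ultimately show ?thesis unfolding b by linarith
qed

text \<open>Here \<open>a\<close> stands for x - y. If |a| > 2R, both weights vanish because |w|
  \<le> R. Otherwise, expanding the squared bump in the increment of |a|^2 / R^2 leaves three terms
  of order |w|^2 / R.\<close>

lemma bump_field_taylor:
  fixes a w :: "'a::real_inner"
  assumes R: "0 < R" and w: "norm w \<le> R"
  shows "norm ((bump R (a + w))\<^sup>2 *\<^sub>R (a + w) - (bump R a)\<^sup>2 *\<^sub>R a
      - ((bump R a)\<^sup>2 *\<^sub>R w - (4 / R\<^sup>2 * bump R a * (a \<bullet> w)) *\<^sub>R a))
    \<le> 100 * (norm w)\<^sup>2 / R * indicator (cball 0 (2 * R)) a"
proof (cases "norm a \<le> 2 * R")
  case False
  have "norm a - norm w \<le> norm (a + w)" by (metis norm_diff_ineq)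
  then have "bump R (a + w) = 0" "bump R a = 0" using False R w by (auto intro!: bump_eq_0)
  then show ?thesis using R by simp
next
  case True
  define c where "c = bump R a"
  \<comment> \<open>\<open>d\<close> is the increment of |.|^2 / R^2 from \<open>a\<close> to
    \<open>a + w\<close>, and \<open>e\<close> the first-order remainder of the squared
    bump.\<close>
  define d where "d = (2 * (a \<bullet> w) + (norm w)\<^sup>2) / R\<^sup>2"
  define e where "e = (bump R (a + w))\<^sup>2 - c\<^sup>2 + 2 * c * d"
  have c: "0 \<le> c" "c \<le> 1" using bump_nonneg bump_le_1 by (auto simp: c_def)
  have nn: "(norm (a + w))\<^sup>2 = (norm a)\<^sup>2 + (2 * (a \<bullet> w) + (norm w)\<^sup>2)"
    by (simp add: power2_norm_eq_inner inner_simps inner_commute)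
  have dv: "(norm (a + w))\<^sup>2 / R\<^sup>2 - (norm a)\<^sup>2 / R\<^sup>2 = d" unfolding nn d_def by (simp add: add_divide_distrib)
  have "\<bar>e\<bar> \<le> d\<^sup>2"
    using hinge_sq_taylor(1)[of "(norm (a + w))\<^sup>2 / R\<^sup>2" "(norm a)\<^sup>2 / R\<^sup>2"]
    unfolding dv by (simp add: e_def c_def bump_def)
  have aw: "\<bar>a \<bullet> w\<bar> \<le> 2 * R * norm w"
    using Cauchy_Schwarz_ineq2[of a w] mult_right_mono[OF True norm_ge_zero[of w]] by linarith
  have "\<bar>2 * (a \<bullet> w) + (norm w)\<^sup>2\<bar> \<le> 2 * (2 * R * norm w) + R * norm w"
    using aw mult_right_mono[OF w norm_ge_zero[of w]] zero_le_square[of "norm w"]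
    unfolding power2_eq_square by linarith
  then have dle: "\<bar>d\<bar> \<le> 5 * norm w / R"
    using R unfolding d_def abs_divide by (simp add: divide_le_eq power2_eq_square algebra_simps)
  have d2: "d\<^sup>2 \<le> (5 * norm w / R)\<^sup>2" using dle by (rule power2_le_iff_abs_le[THEN iffD2, rotated]) (use R in auto)
  have naw: "norm (a + w) \<le> 3 * R" using norm_triangle_ineq[of a w] True w by linarith
  have eq: "(bump R (a + w))\<^sup>2 = c\<^sup>2 - 2 * c * d + e" by (simp add: e_def)
  have split: "(bump R (a + w))\<^sup>2 *\<^sub>R (a + w) - (bump R a)\<^sup>2 *\<^sub>R a
      - ((bump R a)\<^sup>2 *\<^sub>R w - (4 / R\<^sup>2 * bump R a * (a \<bullet> w)) *\<^sub>R a)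
      = e *\<^sub>R (a + w) - (2 * c * (norm w)\<^sup>2 / R\<^sup>2) *\<^sub>R a - (2 * c * d) *\<^sub>R w"
  proof -
    have cd: "2 * c * d = 4 / R\<^sup>2 * c * (a \<bullet> w) + 2 * c * (norm w)\<^sup>2 / R\<^sup>2"
      by (simp add: d_def add_divide_distrib algebra_simps)
    have "(bump R (a + w))\<^sup>2 *\<^sub>R (a + w) = (c\<^sup>2 + e) *\<^sub>R (a + w) - (2 * c * d) *\<^sub>R a - (2 * c * d) *\<^sub>R w"
      unfolding eq by (simp add: algebra_simps)
    also have "(2 * c * d) *\<^sub>R a = (4 / R\<^sup>2 * c * (a \<bullet> w)) *\<^sub>R a + (2 * c * (norm w)\<^sup>2 / R\<^sup>2) *\<^sub>R a"
      unfolding cd by (simp add: scaleR_add_left)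
    finally show ?thesis unfolding c_def[symmetric] by (simp add: algebra_simps)
  qed
  have 1: "norm (e *\<^sub>R (a + w)) \<le> (5 * norm w / R)\<^sup>2 * (3 * R)"
    unfolding norm_scaleR using \<open>\<bar>e\<bar> \<le> d\<^sup>2\<close> d2 naw by (intro mult_mono) auto
  have 2: "norm ((2 * c * (norm w)\<^sup>2 / R\<^sup>2) *\<^sub>R a) \<le> (2 * 1 * (norm w)\<^sup>2 / R\<^sup>2) * (2 * R)"
    unfolding norm_scaleR using c True
    by (intro mult_mono) (auto simp: abs_mult divide_right_mono mult_left_le_one_le)
  have 3: "norm ((2 * c * d) *\<^sub>R w) \<le> (2 * 1 * (5 * norm w / R)) * norm w"
    unfolding norm_scaleR abs_mult using c dle by (intro mult_mono) auto
  have "norm (e *\<^sub>R (a + w) - (2 * c * (norm w)\<^sup>2 / R\<^sup>2) *\<^sub>R a - (2 * c * d) *\<^sub>R w)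
     \<le> norm (e *\<^sub>R (a + w)) + norm ((2 * c * (norm w)\<^sup>2 / R\<^sup>2) *\<^sub>R a) + norm ((2 * c * d) *\<^sub>R w)"
    by (meson norm_triangle_le_diff order_refl add_mono)
  also have "\<dots> \<le> (5 * norm w / R)\<^sup>2 * (3 * R) + (2 * 1 * (norm w)\<^sup>2 / R\<^sup>2) * (2 * R) + (2 * 1 * (5 * norm w / R)) * norm w"
    using 1 2 3 by linarith
  \<comment> \<open>The three terms contribute 75, 4 and 10.\<close>
  also have "\<dots> = 89 * (norm w)\<^sup>2 / R"
    using R by (simp add: field_simps power2_eq_square)
  also have "\<dots> \<le> 100 * (norm w)\<^sup>2 / R" using R by (intro divide_right_mono) auto
  finally show ?thesis unfolding split using True by simp
qed

section \<open>Orthonormal systems\<close>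

lemma norm_sum_orthonormal:
  fixes B :: "'a::euclidean_space set"
  assumes B: "finite B" "pairwise orthogonal B" "\<And>b. b \<in> B \<Longrightarrow> norm b = 1"
  shows "(norm (\<Sum>b\<in>B. c b *\<^sub>R b))\<^sup>2 = (\<Sum>b\<in>B. (c b)\<^sup>2)"
proof -
  have "(norm (\<Sum>b\<in>B. c b *\<^sub>R b))\<^sup>2 = (\<Sum>b\<in>B. (norm (c b *\<^sub>R b))\<^sup>2)"
    using B by (intro norm_sum_Pythagorean)
       (auto simp: pairwise_def orthogonal_clauses)
  also have "\<dots> = (\<Sum>b\<in>B. (c b)\<^sup>2)" using B by (intro sum.cong) auto
  finally show ?thesis .
qed

lemma orthonormal_inner_sum:
  assumes B: "finite B" "pairwise orthogonal B" "\<And>b. b \<in> B \<Longrightarrow> norm b = 1" and "b \<in> B"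
  shows "(\<Sum>x\<in>B. c x *\<^sub>R x) \<bullet> b = c b"
proof -
  have "(\<Sum>x\<in>B. c x *\<^sub>R x) \<bullet> b = (\<Sum>x\<in>B. c x * (x \<bullet> b))" by (simp add: inner_sum_left)
  also have "\<dots> = (\<Sum>x\<in>B. if x = b then c x else 0)"
    using B \<open>b \<in> B\<close> by (intro sum.cong)
      (auto simp: pairwise_def orthogonal_def power2_norm_eq_inner[symmetric])
  finally show ?thesis using B \<open>b \<in> B\<close> by simp
qed

lemma bessel_inequality:
  fixes B :: "'a::euclidean_space set"
  assumes B: "finite B" "pairwise orthogonal B" "\<And>b. b \<in> B \<Longrightarrow> norm b = 1"
  shows "(\<Sum>b\<in>B. (a \<bullet> b)\<^sup>2) \<le> (norm a)\<^sup>2"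
proof -
  define q where "q = (\<Sum>b\<in>B. (a \<bullet> b) *\<^sub>R b)"
  have q: "(norm q)\<^sup>2 = (\<Sum>b\<in>B. (a \<bullet> b)\<^sup>2)"
    unfolding q_def by (rule norm_sum_orthonormal[OF B])
  have "a \<bullet> q = (\<Sum>b\<in>B. (a \<bullet> b)\<^sup>2)" by (simp add: q_def inner_sum_right power2_eq_square)
  then have "(norm (a - q))\<^sup>2 = (norm a)\<^sup>2 - (\<Sum>b\<in>B. (a \<bullet> b)\<^sup>2)"
    using q by (simp add: power2_norm_eq_inner inner_simps inner_commute)
  then show ?thesis using zero_le_power2[of "norm (a - q)"] by linarith
qed

text \<open>Gram-Schmidt with control of \<open>L\<close>. While fewer than \<open>k\<close> vectors
  are found, \<open>thick\<close> supplies a \<open>w\<close> in \<open>S\<close> far from their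
  span; the normalised residual is the next vector, and linearity bounds its image.\<close>

lemma orthonormal_extension_bound:
  fixes L :: "'a::euclidean_space \<Rightarrow> 'a"
  assumes L: "linear L" and \<delta>: "0 < \<delta>" and r: "0 < r" and \<tau>: "0 \<le> \<tau>"
    and S: "\<And>w. w \<in> S \<Longrightarrow> norm w \<le> r" "\<And>w. w \<in> S \<Longrightarrow> norm (L w) \<le> \<tau>"
    and thick: "\<And>B. finite B \<Longrightarrow> pairwise orthogonal B \<Longrightarrow> (\<And>b. b \<in> B \<Longrightarrow> norm b = 1) \<Longrightarrow> card B < k \<Longrightarrow>
      \<exists>w\<in>S. \<delta> * r \<le> norm (w - (\<Sum>b\<in>B. (w \<bullet> b) *\<^sub>R b))"
    and "j \<le> k"
  shows "\<exists>B. finite B \<and> pairwise orthogonal B \<and> (\<forall>b\<in>B. norm b = 1) \<and> card B = j \<and>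
      (\<forall>b\<in>B. norm (L b) \<le> ((1 + real k) / \<delta> + 1) ^ j * \<tau> / r)"
  using \<open>j \<le> k\<close>
proof (induction j)
  case 0
  show ?case by (rule exI[of _ "{}"]) auto
next
  case (Suc j)
  \<comment> \<open>Loss per step: the factor \<open>1 + real k\<close> comes from subtracting the
    projection, \<open>1 / \<delta>\<close> from normalising. The last summand makes
    \<open>Q\<close> at least 1, so that the bounds for earlier vectors persist.\<close>
  define Q where "Q = (1 + real k) / \<delta> + 1"
  have Q: "1 \<le> Q" using \<delta> by (simp add: Q_def)
  obtain B where B: "finite B" "pairwise orthogonal B" "\<And>b. b \<in> B \<Longrightarrow> norm b = 1" "card B = j"
    "\<And>b. b \<in> B \<Longrightarrow> norm (L b) \<le> Q ^ j * \<tau> / r" using Suc unfolding Q_def by auto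
  obtain w where w: "w \<in> S" "\<delta> * r \<le> norm (w - (\<Sum>b\<in>B. (w \<bullet> b) *\<^sub>R b))"
    using thick[OF B(1-3)] B(4) Suc.prems by auto
  define v where "v = w - (\<Sum>b\<in>B. (w \<bullet> b) *\<^sub>R b)"
  have nv: "0 < norm v" "\<delta> * r \<le> norm v" using w mult_pos_pos[OF \<delta> r] unfolding v_def by linarith+
  define e where "e = v /\<^sub>R norm v"
  have e1: "norm e = 1" using nv by (simp add: e_def)
  have orth: "orthogonal v b" if "b \<in> B" for b
    using orthonormal_inner_sum[OF B(1-3) that] by (simp add: v_def orthogonal_def inner_diff_left)
  then have orthe: "orthogonal e b" if "b \<in> B" for b using that by (simp add: e_def orthogonal_clauses)
  have enB: "e \<notin> B" using orthe e1 by (metis norm_zero orthogonal_self zero_neq_one)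
  have Lv: "norm (L v) \<le> (1 + real k) * (Q ^ j * \<tau>)"
  proof -
    have "L v = L w - (\<Sum>b\<in>B. (w \<bullet> b) *\<^sub>R L b)"
      by (simp add: v_def linear_diff[OF L] linear_sum[OF L] linear_scale[OF L])
    then have "norm (L v) \<le> norm (L w) + (\<Sum>b\<in>B. norm ((w \<bullet> b) *\<^sub>R L b))"
      by (metis norm_triangle_le_diff norm_sum add_left_mono)
    also have "\<dots> \<le> Q ^ j * \<tau> + (\<Sum>b\<in>B. Q ^ j * \<tau>)"
    proof (intro add_mono sum_mono)
      show "norm (L w) \<le> Q ^ j * \<tau>"
        using S(2)[OF w(1)] mult_right_mono[OF one_le_power[OF Q, of j] \<tau>] by simp
      fix b assume b: "b \<in> B"
      have "\<bar>w \<bullet> b\<bar> \<le> r" using Cauchy_Schwarz_ineq2[of w b] B(3)[OF b] S(1)[OF w(1)] by simp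
      then have "norm ((w \<bullet> b) *\<^sub>R L b) \<le> r * (Q ^ j * \<tau> / r)"
        unfolding norm_scaleR using B(5)[OF b] r by (intro mult_mono) auto
      then show "norm ((w \<bullet> b) *\<^sub>R L b) \<le> Q ^ j * \<tau>" using r by simp
    qed
    also have "\<dots> = (1 + real j) * (Q ^ j * \<tau>)" using B(4) by (simp add: algebra_simps)
    also have "\<dots> \<le> (1 + real k) * (Q ^ j * \<tau>)" using Suc.prems Q \<tau> by (intro mult_right_mono) auto
    finally show ?thesis .
  qed
  have QS: "Q ^ j * \<tau> / r \<le> Q ^ Suc j * \<tau> / r"
    using Q \<tau> r by (intro divide_right_mono mult_right_mono power_increasing) auto
  have "norm (L e) = norm (L v) / norm v" by (simp add: e_def linear_scale[OF L] divide_inverse)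
  also have "\<dots> \<le> (1 + real k) * (Q ^ j * \<tau>) / (\<delta> * r)"
    using Lv nv \<delta> r Q \<tau> by (intro frac_le) auto
  also have "\<dots> = ((1 + real k) / \<delta>) * (Q ^ j * \<tau> / r)" by simp
  also have "\<dots> \<le> Q * (Q ^ j * \<tau> / r)"
    using Q \<tau> r by (intro mult_right_mono) (auto simp: Q_def)
  also have "\<dots> = Q ^ Suc j * \<tau> / r" by simp
  finally have Le: "norm (L e) \<le> Q ^ Suc j * \<tau> / r" .
  show ?case
    unfolding Q_def[symmetric]
  proof (intro exI[of _ "insert e B"] conjI)
    show "pairwise orthogonal (insert e B)"
      using B(2) orthe by (auto simp: pairwise_insert orthogonal_commute)
    show "\<forall>b\<in>insert e B. norm (L b) \<le> Q ^ Suc j * \<tau> / r" using Le B(5) QS by (auto intro: order_trans)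
  qed (use B enB e1 in auto)
qed

section \<open>Averages of a finite measure against the weight\<close>

text \<open>Both sides vanish at l = 1, where their derivatives are 2p and 2q; hence l slightly
  above 1 works.\<close>

lemma exists_dilation_factor:
  fixes p q :: real
  assumes "p < q"
  shows "\<exists>l>1. 2 * (l powr p - 1) \<le> q * (1 - 1 / l\<^sup>2)"
proof -
  define g where "g = (\<lambda>l::real. 2 * (l powr p - 1) - q * (1 - 1 / l\<^sup>2))"
  have "DERIV g 1 :> 2 * p - 2 * q"
    unfolding g_def by (rule derivative_eq_intros refl | simp)+
  from DERIV_neg_dec_right[OF this]
  obtain d where d: "d > 0" "\<And>h. h > 0 \<Longrightarrow> h < d \<Longrightarrow> g (1 + h) < g 1"
    using assms by auto
  have "g (1 + d / 2) < g 1" using d by simp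
  then show ?thesis using d(1) by (intro exI[of _ "1 + d / 2"]) (simp add: g_def)
qed

lemma null_sequence_attains_max:
  fixes f :: "nat \<Rightarrow> real"
  assumes lim: "f \<longlonglongrightarrow> 0" and "0 < f 0"
  shows "\<exists>n. \<forall>m. f m \<le> f n"
proof -
  have "eventually (\<lambda>n. f n < f 0) sequentially"
    using lim \<open>0 < f 0\<close> by (rule order_tendstoD)
  then obtain N where N: "\<And>n. n \<ge> N \<Longrightarrow> f n < f 0" by (auto simp: eventually_sequentially)
  have fin: "finite (f ` {..N})" by simp
  have "Max (f ` {..N}) \<in> f ` {..N}" using fin by (intro Max_in) auto
  then obtain n where n: "Max (f ` {..N}) = f n" by (rule imageE)
  have "f m \<le> f n" for m
  proof (cases "m \<le> N")
    case True then show ?thesis using Max_ge[OF fin, of "f m"] n by simp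
  next
    case False
    then have "f m < f 0" using N by simp
    also have "f 0 \<le> f n" using Max_ge[OF fin, of "f 0"] n by simp
    finally show ?thesis by simp
  qed
  then show ?thesis by blast
qed

section \<open>Mass, moment and vector field of a finite measure\<close>

locale finite_euclidean_measure = finite_measure M
  for M :: "'a::euclidean_space measure" +
  assumes sets_M [measurable_cong, simp]: "sets M = sets borel"
begin

lemma space_M [simp]: "space M = UNIV"
  using sets_eq_imp_space_eq[OF sets_M] by simp

definition bmass :: "real \<Rightarrow> 'a \<Rightarrow> real" where
  "bmass R x = (\<integral>y. (bump R (x - y))\<^sup>2 \<partial>M)"

text \<open>Both the trace of the operator \<open>Q\<close> in \<open>bderiv\<close> and \<open>R\<close> times the derivative of \<open>bmass\<close> in \<open>R\<close>.\<close>

definition bmoment :: "real \<Rightarrow> 'a \<Rightarrow> real" where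
  "bmoment R x = (\<integral>y. 4 / R\<^sup>2 * bump R (x - y) * (norm (x - y))\<^sup>2 \<partial>M)"

text \<open>No negative power of the distance occurs: averaging truncated Riesz kernels over the
  truncation radius with \<open>weight_density\<close> cancels the denominator.\<close>

definition bfield :: "real \<Rightarrow> 'a \<Rightarrow> 'a" where
  "bfield R x = (\<integral>y. (bump R (x - y))\<^sup>2 *\<^sub>R (x - y) \<partial>M)"

text \<open>The derivative of \<open>bfield R\<close> at \<open>x\<close> in direction \<open>w\<close>.\<close>

definition bderiv :: "real \<Rightarrow> 'a \<Rightarrow> 'a \<Rightarrow> 'a" where
  "bderiv R x w = (\<integral>y. (bump R (x - y))\<^sup>2 *\<^sub>R w
      - (4 / R\<^sup>2 * bump R (x - y) * ((x - y) \<bullet> w)) *\<^sub>R (x - y) \<partial>M)"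

lemma integrable_bump_sq: "integrable M (\<lambda>y. (bump R (x - y))\<^sup>2)"
  by (rule integrable_const_bound[where B = 1]) (auto simp: bump_sq_le_1)

lemma bump_times_norm_sq_le:
  assumes R: "0 < R" shows "bump R (z::'a) * (norm z)\<^sup>2 \<le> R\<^sup>2"
proof (cases "norm z \<le> R")
  case True
  then have "(norm z)\<^sup>2 \<le> R\<^sup>2" by (intro power_mono) auto
  then have "bump R z * (norm z)\<^sup>2 \<le> 1 * R\<^sup>2"
    using bump_le_1[of R z] by (intro mult_mono) auto
  then show ?thesis by simp
qed (use R bump_eq_0[of R z] in auto)

lemma integrable_bmoment:
  assumes R: "0 < R"
  shows "integrable M (\<lambda>y. 4 / R\<^sup>2 * bump R (x - y) * (norm (x - y))\<^sup>2)"
proof (rule integrable_const_bound[where B = 4])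
  have "norm (4 / R\<^sup>2 * bump R (x - y) * (norm (x - y))\<^sup>2) \<le> 4" for y
    using bump_times_norm_sq_le[OF R, of "x - y"] R bump_nonneg[of R "x - y"]
    by (simp add: field_simps)
  then show "AE y in M. norm (4 / R\<^sup>2 * bump R (x - y) * (norm (x - y))\<^sup>2) \<le> 4" by simp
qed measurable

lemma integrable_bfield:
  assumes R: "0 < R"
  shows "integrable M (\<lambda>y. (bump R (x - y))\<^sup>2 *\<^sub>R (x - y))"
  by (rule integrable_const_bound[where B = R]) (use norm_bump_scaleR_le[OF R] in auto)

lemma integrable_bderiv:
  assumes R: "0 < R"
  shows "integrable M (\<lambda>y. (bump R (x - y))\<^sup>2 *\<^sub>R w
      - (4 / R\<^sup>2 * bump R (x - y) * ((x - y) \<bullet> w)) *\<^sub>R (x - y))"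
proof (intro Bochner_Integration.integrable_diff integrable_scaleR_left)
  show "integrable M (\<lambda>y. (bump R (x - y))\<^sup>2)" by (rule integrable_bump_sq)
  show "integrable M (\<lambda>y. (4 / R\<^sup>2 * bump R (x - y) * ((x - y) \<bullet> w)) *\<^sub>R (x - y))"
  proof (rule integrable_const_bound[where B = "4 * norm w"])
    have "norm ((4 / R\<^sup>2 * bump R z * (z \<bullet> w)) *\<^sub>R z) \<le> 4 * norm w" for z
    proof -
      have "norm ((4 / R\<^sup>2 * bump R z * (z \<bullet> w)) *\<^sub>R z)
          \<le> 4 / R\<^sup>2 * bump R z * (norm z * norm w) * norm z"
        using Cauchy_Schwarz_ineq2[of z w] bump_nonneg[of R z]
        by (auto simp: abs_mult intro!: mult_right_mono mult_left_mono divide_right_mono)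
      also have "\<dots> = 4 / R\<^sup>2 * norm w * (bump R z * (norm z)\<^sup>2)" by (simp add: power2_eq_square)
      also have "\<dots> \<le> 4 / R\<^sup>2 * norm w * R\<^sup>2"
        by (intro mult_left_mono bump_times_norm_sq_le R) auto
      finally show ?thesis using R by simp
    qed
    then show "AE y in M. norm ((4 / R\<^sup>2 * bump R (x - y) * ((x - y) \<bullet> w)) *\<^sub>R (x - y)) \<le> 4 * norm w"
      by simp
  qed measurable
qed

lemma linear_bderiv: "0 < R \<Longrightarrow> linear (bderiv R x)"
proof (rule linearI)
  fix v w :: 'a and c :: real assume R: "0 < R"
  have add: "a *\<^sub>R (v + w) - (b * (z \<bullet> (v + w))) *\<^sub>R z
      = (a *\<^sub>R v - (b * (z \<bullet> v)) *\<^sub>R z) + (a *\<^sub>R w - (b * (z \<bullet> w)) *\<^sub>R z)" for a b and z :: 'a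
    by (simp add: algebra_simps inner_add_right)
  show "bderiv R x (v + w) = bderiv R x v + bderiv R x w"
    unfolding bderiv_def add
    by (rule Bochner_Integration.integral_add[OF integrable_bderiv integrable_bderiv, OF R R])
  have scale: "a *\<^sub>R (c *\<^sub>R w) - (b * (z \<bullet> (c *\<^sub>R w))) *\<^sub>R z
      = c *\<^sub>R (a *\<^sub>R w - (b * (z \<bullet> w)) *\<^sub>R z)" for a b and z :: 'a
    by (simp add: algebra_simps)
  show "bderiv R x (c *\<^sub>R w) = c *\<^sub>R bderiv R x w"
    unfolding bderiv_def scale by (rule integral_scaleR_right)
qed

text \<open>Tracing the integrand over \<open>B\<close> gives \<open>card B\<close> times the weight
  minus a multiple of the squared length of the projection of x - y to the span of \<open>B\<close>;
  Bessel's inequality replaces the latter by the full squared norm.\<close>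

lemma bderiv_trace_ge:
  assumes R: "0 < R" and B: "finite B" "pairwise orthogonal B" "\<And>b. b \<in> B \<Longrightarrow> norm b = 1"
  shows "real (card B) * bmass R x - bmoment R x \<le> (\<Sum>e\<in>B. bderiv R x e \<bullet> e)"
proof -
  define f where "f = (\<lambda>e y. (bump R (x - y))\<^sup>2 *\<^sub>R e
      - (4 / R\<^sup>2 * bump R (x - y) * ((x - y) \<bullet> e)) *\<^sub>R (x - y))"
  have f: "integrable M (f e)" for e unfolding f_def by (rule integrable_bderiv[OF R])
  have "real (card B) * bmass R x - bmoment R x
      = (\<integral>y. real (card B) * (bump R (x - y))\<^sup>2 - 4 / R\<^sup>2 * bump R (x - y) * (norm (x - y))\<^sup>2 \<partial>M)"
    unfolding bmass_def bmoment_def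
    by (subst Bochner_Integration.integral_diff)
       (use integrable_bump_sq integrable_bmoment[OF R] in auto)
  also have "\<dots> \<le> (\<integral>y. (\<Sum>e\<in>B. f e y \<bullet> e) \<partial>M)"
  proof (rule integral_mono)
    show "integrable M (\<lambda>y. real (card B) * (bump R (x - y))\<^sup>2 - 4 / R\<^sup>2 * bump R (x - y) * (norm (x - y))\<^sup>2)"
      using integrable_bump_sq integrable_bmoment[OF R] by auto
    show "integrable M (\<lambda>y. \<Sum>e\<in>B. f e y \<bullet> e)" using f by auto
    fix y
    have "(\<Sum>e\<in>B. f e y \<bullet> e) = (\<Sum>e\<in>B. (bump R (x - y))\<^sup>2 - 4 / R\<^sup>2 * bump R (x - y) * ((x - y) \<bullet> e)\<^sup>2)"
    proof (rule sum.cong)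
      fix e assume "e \<in> B"
      then have "e \<bullet> e = 1" using B(3) by (simp add: power2_norm_eq_inner[symmetric])
      then show "f e y \<bullet> e = (bump R (x - y))\<^sup>2 - 4 / R\<^sup>2 * bump R (x - y) * ((x - y) \<bullet> e)\<^sup>2"
        unfolding f_def by (simp add: inner_diff_left power2_eq_square)
    qed simp
    also have "\<dots> = real (card B) * (bump R (x - y))\<^sup>2 - 4 / R\<^sup>2 * bump R (x - y) * (\<Sum>e\<in>B. ((x - y) \<bullet> e)\<^sup>2)"
      by (simp add: sum_subtractf sum_distrib_left)
    also have "\<dots> \<ge> real (card B) * (bump R (x - y))\<^sup>2 - 4 / R\<^sup>2 * bump R (x - y) * (norm (x - y))\<^sup>2"
      using bessel_inequality[OF B, of "x - y"] bump_nonneg[of R "x - y"]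
      by (intro diff_left_mono mult_left_mono) auto
    finally show "real (card B) * (bump R (x - y))\<^sup>2 - 4 / R\<^sup>2 * bump R (x - y) * (norm (x - y))\<^sup>2
        \<le> (\<Sum>e\<in>B. f e y \<bullet> e)" .
  qed
  also have "\<dots> = (\<Sum>e\<in>B. bderiv R x e \<bullet> e)"
    using f by (simp add: bderiv_def f_def)
  finally show ?thesis .
qed

text \<open>Convexity of the weight in \<open>1/R\<^sup>2\<close> bounds the derivative of \<open>bmass\<close> by a finite difference.\<close>

lemma bmoment_le_dilation:
  assumes R: "0 < R" and l: "1 < l"
  shows "(1 - 1 / l\<^sup>2) / 2 * bmoment R x \<le> bmass (l * R) x - bmass R x"
proof -
  have "(1 - 1 / l\<^sup>2) / 2 * bmoment R x
      = (\<integral>y. (1 - 1 / l\<^sup>2) / 2 * (4 / R\<^sup>2 * bump R (x - y) * (norm (x - y))\<^sup>2) \<partial>M)"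
    unfolding bmoment_def by (rule integral_mult_right_zero[symmetric])
  also have "\<dots> \<le> (\<integral>y. (bump (l * R) (x - y))\<^sup>2 - (bump R (x - y))\<^sup>2 \<partial>M)"
  proof (rule integral_mono)
    fix y
    have eq: "t / 2 * (4 / R\<^sup>2 * a * b) = 2 * t * (a * b / R\<^sup>2)" for t a b :: real by simp
    show "(1 - 1 / l\<^sup>2) / 2 * (4 / R\<^sup>2 * bump R (x - y) * (norm (x - y))\<^sup>2)
        \<le> (bump (l * R) (x - y))\<^sup>2 - (bump R (x - y))\<^sup>2"
      unfolding eq by (rule bump_sq_dilate[OF R l])
  qed (intro integrable_mult_right integrable_bmoment[OF R] Bochner_Integration.integrable_diff integrable_bump_sq)+
  also have "\<dots> = bmass (l * R) x - bmass R x"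
    unfolding bmass_def by (rule Bochner_Integration.integral_diff[OF integrable_bump_sq integrable_bump_sq])
  finally show ?thesis .
qed

lemma bmass_mono: "0 < R \<Longrightarrow> R \<le> R' \<Longrightarrow> bmass R x \<le> bmass R' x"
  unfolding bmass_def
  by (intro integral_mono integrable_bump_sq power_mono bump_mono bump_nonneg)

lemma bmass_le_measure:
  assumes R: "0 < R" shows "bmass R x \<le> measure M (cball x R)"
proof -
  have "bmass R x \<le> (\<integral>y. indicator (cball x R) y \<partial>M)"
    unfolding bmass_def
  proof (rule integral_mono[OF integrable_bump_sq])
    fix y
    show "(bump R (x - y))\<^sup>2 \<le> indicator (cball x R) y"
      using bump_sq_le_1[of R "x - y"] bump_eq_0[OF R, of "x - y"] by (auto simp: indicator_def dist_norm)
  qed (auto simp: less_top[symmetric])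
  then show ?thesis by simp
qed

lemma measure_le_bmass:
  assumes R: "0 < R" and \<theta>: "0 \<le> \<theta>" "\<theta> \<le> 1"
  shows "(1 - \<theta>\<^sup>2)\<^sup>2 * measure M (cball x (\<theta> * R)) \<le> bmass R x"
proof -
  have th: "0 \<le> 1 - \<theta>\<^sup>2" using \<theta> by (simp add: power_le_one)
  have "(\<integral>y. (1 - \<theta>\<^sup>2)\<^sup>2 * indicator (cball x (\<theta> * R)) y \<partial>M) \<le> bmass R x"
    unfolding bmass_def
  proof (rule integral_mono[OF _ integrable_bump_sq])
    fix y
    show "(1 - \<theta>\<^sup>2)\<^sup>2 * indicator (cball x (\<theta> * R)) y \<le> (bump R (x - y))\<^sup>2"
      using th bump_ge[OF R, of "x - y" \<theta>] by (auto simp: indicator_def dist_norm intro!: power_mono)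
  qed (auto simp: less_top[symmetric])
  then show ?thesis by simp
qed

text \<open>The pointwise estimate at a = x - y is integrated in y, which turns the indicator into
  the mass of the doubled ball.\<close>

lemma bfield_taylor:
  assumes R: "0 < R" and w: "norm w \<le> R"
  shows "norm (bfield R (x + w) - bfield R x - bderiv R x w)
    \<le> 100 * (norm w)\<^sup>2 / R * measure M (cball x (2 * R))"
proof -
  have eq: "bfield R (x + w) - bfield R x - bderiv R x w
      = (\<integral>y. (bump R ((x - y) + w))\<^sup>2 *\<^sub>R ((x - y) + w) - (bump R (x - y))\<^sup>2 *\<^sub>R (x - y)
        - ((bump R (x - y))\<^sup>2 *\<^sub>R w - (4 / R\<^sup>2 * bump R (x - y) * ((x - y) \<bullet> w)) *\<^sub>R (x - y)) \<partial>M)"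
    (is "_ = (\<integral>y. ?f y \<partial>M)")
    unfolding bfield_def bderiv_def diff_add_eq
    by (simp only: Bochner_Integration.integral_diff integrable_bfield[OF R] integrable_bderiv[OF R]
        Bochner_Integration.integrable_diff)
  have "norm (\<integral>y. ?f y \<partial>M) \<le> (\<integral>y. norm (?f y) \<partial>M)" by (rule integral_norm_bound)
  also have "\<dots> \<le> (\<integral>y. 100 * (norm w)\<^sup>2 / R * indicator (cball x (2 * R)) y \<partial>M)"
  proof (rule integral_mono)
    show "integrable M (\<lambda>y. norm (?f y))"
      unfolding diff_add_eq
      by (intro integrable_norm Bochner_Integration.integrable_diff[OF _ integrable_bderiv[OF R]]
          Bochner_Integration.integrable_diff[OF integrable_bfield[OF R] integrable_bfield[OF R]])
    fix y
    have "indicator (cball 0 (2 * R)) (x - y) = (indicator (cball x (2 * R)) y :: real)"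
      by (simp add: indicator_def dist_norm norm_minus_commute)
    then show "norm (?f y) \<le> 100 * (norm w)\<^sup>2 / R * indicator (cball x (2 * R)) y"
      using bump_field_taylor[OF R w, of "x - y"] by simp
  qed (auto simp: less_top[symmetric])
  finally show ?thesis unfolding eq by simp
qed

end

section \<open>Averaging truncated Riesz transforms\<close>

context
  fixes s R :: real
  assumes s: "0 < s" and R: "0 < R"
begin

text \<open>Dividing \<open>weight_primitive\<close> by \<open>t powr (s + 1)\<close>, the denominator of the Riesz kernel, leaves the square of the bump.\<close>

definition weight_primitive :: "real \<Rightarrow> real" where
  "weight_primitive t = t powr (s + 1) * (1 - t\<^sup>2 / R\<^sup>2)\<^sup>2"

text \<open>The derivative of \<open>weight_primitive\<close> at positive arguments. Since the
  primitive vanishes at 0 and at \<open>R\<close>, this density has mean zero on (0, R).\<close>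

definition weight_density :: "real \<Rightarrow> real" where
  "weight_density t = (s + 1) * t powr s * (1 - t\<^sup>2 / R\<^sup>2)\<^sup>2
     - 4 * t powr s * (t\<^sup>2 / R\<^sup>2) * (1 - t\<^sup>2 / R\<^sup>2)"

lemma weight_density_bound:
  assumes t: "0 < t" "t < R"
  shows "\<bar>weight_density t\<bar> \<le> (s + 5) * t powr s"
proof -
  define q where "q = t\<^sup>2 / R\<^sup>2"
  have "t\<^sup>2 \<le> R\<^sup>2" using t by (intro power_mono) auto
  then have q: "0 \<le> q" "q \<le> 1" using R by (auto simp: q_def)
  have "(1 - q)\<^sup>2 \<le> 1" using q by (simp add: power_le_one)
  then have 1: "(s + 1) * (1 - q)\<^sup>2 \<le> (s + 1) * 1" using s by (intro mult_left_mono) auto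
  have 2: "q * (1 - q) \<le> 1 * 1" using q by (intro mult_mono) auto
  have 3: "0 \<le> (s + 1) * (1 - q)\<^sup>2" "0 \<le> q * (1 - q)" using q s by auto
  have "weight_density t = ((s + 1) * (1 - q)\<^sup>2 - 4 * (q * (1 - q))) * t powr s"
    by (simp add: weight_density_def q_def[symmetric] algebra_simps)
  moreover have "\<bar>a - 4 * b\<bar> \<le> s + 5" if "a \<le> (s + 1) * 1" "b \<le> 1 * 1" "0 \<le> a" "0 \<le> b" for a b
    using that s by (simp add: abs_le_iff)
  note this[OF 1 2 3]
  ultimately show ?thesis by (simp add: abs_mult mult_right_mono)
qed

lemma weight_density_measurable [measurable]: "weight_density \<in> borel_measurable borel"
  unfolding weight_density_def by measurable

lemma weight_density_integrable:
  assumes b: "b \<le> R"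
  shows "set_integrable lborel {0<..<b} weight_density"
  unfolding set_integrable_def
proof (rule Bochner_Integration.integrable_bound)
  show "integrable lborel (\<lambda>t. indicator {0..R} t *\<^sub>R ((s + 5) * R powr s))"
    by (intro integrable_scaleR_left integrable_real_indicator) (auto simp: R less_imp_le)
  have "norm (indicator {0<..<b} t *\<^sub>R weight_density t) \<le> norm (indicator {0..R} t *\<^sub>R ((s + 5) * R powr s))" for t
  proof (cases "t \<in> {0<..<b}")
    case True
    then have t: "0 < t" "t < R" using b by auto
    have "\<bar>weight_density t\<bar> \<le> (s + 5) * t powr s" by (rule weight_density_bound[OF t])
    also have "\<dots> \<le> (s + 5) * R powr s" using s t by (intro mult_left_mono powr_mono2) auto
    finally show ?thesis using True t s by (simp add: abs_mult)
  qed simp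
  then show "AE t in lborel. norm (indicator {0<..<b} t *\<^sub>R weight_density t)
      \<le> norm (indicator {0..R} t *\<^sub>R ((s + 5) * R powr s))" by simp
qed measurable

lemma weight_density_integral:
  assumes b: "0 \<le> b" "b \<le> R"
  shows "(LINT t:{0<..<b}|lborel. weight_density t) = weight_primitive b"
proof -
  have "(weight_density has_integral (weight_primitive b - weight_primitive 0)) {0..b}"
  \<comment> \<open>The interior version avoids differentiating \<open>powr\<close> at 0.\<close>
  proof (rule fundamental_theorem_of_calculus_interior[OF b(1)])
    show "continuous_on {0..b} weight_primitive"
      unfolding weight_primitive_def using s R
      by (intro continuous_intros continuous_on_powr') auto
    fix t assume "t \<in> {0<..<b}"
    then have t: "0 < t" by simp
    have "(weight_primitive has_real_derivative
        ((s + 1) * t powr (s + 1 - 1)) * (1 - t\<^sup>2 / R\<^sup>2)\<^sup>2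
          + t powr (s + 1) * (2 * (1 - t\<^sup>2 / R\<^sup>2) * (- (2 * t / R\<^sup>2)))) (at t)"
      unfolding weight_primitive_def using t R
      by (auto intro!: derivative_eq_intros simp: power2_eq_square)
    moreover have "t powr (s + 1) = t powr s * t" using t by (simp add: powr_add)
    then have "((s + 1) * t powr (s + 1 - 1)) * (1 - t\<^sup>2 / R\<^sup>2)\<^sup>2
          + t powr (s + 1) * (2 * (1 - t\<^sup>2 / R\<^sup>2) * (- (2 * t / R\<^sup>2))) = weight_density t"
      by (simp add: weight_density_def power2_eq_square)
    ultimately have "(weight_primitive has_real_derivative weight_density t) (at t)"
      by (rule DERIV_cong)
    then show "(weight_primitive has_vector_derivative weight_density t) (at t)"
      by (rule has_real_derivative_iff_has_vector_derivative[THEN iffD1])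
  qed
  then have "(weight_density has_integral weight_primitive b) {0<..<b}"
    using s by (simp add: has_integral_Icc_iff_Ioo weight_primitive_def)
  then show ?thesis
    using set_borel_integral_eq_integral(2)[OF weight_density_integrable[OF b(2)]] by (simp add: integral_unique)
qed

end

text \<open>By Fubini, \<open>bfield\<close> is the integral of the truncated transforms against
  \<open>weight_density\<close> over the radii in (0, R). The mean-zero property allows a fixed
  transform to be subtracted, so only the oscillation enters.\<close>

lemma norm_bfield_le_of_truncated_oscillation:
  fixes M :: "(real^'m) measure"
  assumes M: "finite_euclidean_measure M" and s: "0 < s" and R: "0 < R" "R < \<delta>"
    and osc: "\<And>a b. 0 < a \<Longrightarrow> a < \<delta> \<Longrightarrow> 0 < b \<Longrightarrow> b < \<delta> \<Longrightarrow>
      norm (riesz_truncated s M a x - riesz_truncated s M b x) \<le> \<eta>"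
  shows "norm (finite_euclidean_measure.bfield M R x) \<le> (s + 5) * \<eta> * R powr (s + 1)"
proof -
  interpret finite_euclidean_measure M by (rule M)
  define g where "g = weight_density s R"
  have g[measurable]: "g \<in> borel_measurable borel"
    unfolding g_def by (rule weight_density_measurable[OF s R(1)])
  define K where "K = (\<lambda>y. (1 / norm (x - y) powr (s + 1)) *\<^sub>R (x - y))"
  define N where "N = restrict_space lborel {0<..<R}"
  have K[measurable]: "K \<in> borel_measurable borel" unfolding K_def by measurable
  have spN: "space N = {0<..<R}" by (simp add: N_def space_restrict_space)
  have id_N[measurable]: "(\<lambda>t. t) \<in> borel_measurable N"
    unfolding N_def by (rule measurable_restrict_space1) simp
  interpret N: finite_measure N
    by (rule finite_measureI) (use R in \<open>simp add: spN, simp add: N_def emeasure_restrict_space\<close>)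
  interpret P: pair_sigma_finite N M ..
  interpret PF: finite_measure "N \<Otimes>\<^sub>M M"
    by (rule finite_measure_pair_measure) unfold_locales
  define H where "H = (\<lambda>t y. (indicator {y. norm (x - y) > t} y * g t) *\<^sub>R K y)"
  have fst_m[measurable]: "fst \<in> borel_measurable (N \<Otimes>\<^sub>M M)"
    using measurable_comp[OF measurable_fst id_N, of M] by (simp add: comp_def)
  have snd_m[measurable]: "snd \<in> borel_measurable (N \<Otimes>\<^sub>M M)"
    using measurable_snd[of N M] by (simp cong: measurable_cong_sets)
  have Hm: "case_prod H \<in> borel_measurable (N \<Otimes>\<^sub>M M)"
    unfolding H_def indicator_def case_prod_beta by measurable
  have Hb: "norm (H t y) \<le> s + 5" if t: "t \<in> {0<..<R}" for t y
  proof (cases "norm (x - y) > t")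
    case True
    define \<rho> where "\<rho> = norm (x - y)"
    have \<rho>: "0 < t" "t < \<rho>" using True t by (auto simp: \<rho>_def)
    have "norm (K y) = 1 / \<rho> powr s"
      using \<rho> by (simp add: K_def \<rho>_def[symmetric] powr_add)
    then have "norm (H t y) = \<bar>g t\<bar> / \<rho> powr s" using True by (simp add: H_def)
    also have "\<dots> \<le> ((s + 5) * t powr s) / t powr s"
      using weight_density_bound[OF s R(1), of t] t \<rho> s
      unfolding g_def by (intro frac_le powr_mono2) auto
    finally show ?thesis using t by simp
  qed (use s in \<open>simp add: H_def\<close>)
  have Hint: "integrable (N \<Otimes>\<^sub>M M) (case_prod H)"
    by (rule PF.integrable_const_bound[OF _ Hm, of "s + 5"])
       (use Hb in \<open>auto simp: space_pair_measure spN intro!: AE_I2\<close>)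
  have int_t: "(\<integral>t. H t y \<partial>N) = (bump R (x - y))\<^sup>2 *\<^sub>R (x - y)" for y
  proof -
    define \<rho> where "\<rho> = norm (x - y)"
    \<comment> \<open>The truncation keeps exactly the radii \<open>t\<close> below |x - y|, so the
      integral over \<open>t\<close> stops at the smaller of this distance and
      \<open>R\<close>.\<close>
    define b where "b = min R \<rho>"
    have b: "0 \<le> b" "b \<le> R" using R by (auto simp: b_def \<rho>_def)
    have "(\<integral>t. H t y \<partial>N) = (\<integral>t. (indicator {0<..<R} t * indicator {y. norm (x - y) > t} y * g t) *\<^sub>R K y \<partial>lborel)"
      unfolding N_def H_def by (subst integral_restrict_space) (auto simp: mult.assoc)
    also have "\<dots> = (\<integral>t. (indicator {0<..<b} t *\<^sub>R g t) *\<^sub>R K y \<partial>lborel)"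
      by (intro Bochner_Integration.integral_cong) (auto simp: indicator_def b_def \<rho>_def)
    also have "\<dots> = (LINT t:{0<..<b}|lborel. g t) *\<^sub>R K y"
      using weight_density_integrable[OF s R(1) b(2)]
      unfolding set_lebesgue_integral_def set_integrable_def g_def[symmetric]
      by (intro integral_scaleR_left) auto
    also have "(LINT t:{0<..<b}|lborel. g t) = b powr (s + 1) * (1 - b\<^sup>2 / R\<^sup>2)\<^sup>2"
      unfolding g_def weight_density_integral[OF s R(1) b] by (rule weight_primitive_def[OF s R(1)])
    also have "\<dots> *\<^sub>R K y = (bump R (x - y))\<^sup>2 *\<^sub>R (x - y)"
    proof (cases "\<rho> < R")
      case True
      then have "\<rho>\<^sup>2 \<le> R\<^sup>2" by (intro power_mono) (auto simp: \<rho>_def)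
      then have "bump R (x - y) = 1 - \<rho>\<^sup>2 / R\<^sup>2" using R by (simp add: bump_def \<rho>_def)
      moreover have "b = \<rho>" using True by (simp add: b_def)
      \<comment> \<open>At y = x the division by zero is harmless, since \<open>K y\<close> and the
        right-hand side are both 0.\<close>
      ultimately show ?thesis by (cases "\<rho> = 0") (auto simp: K_def \<rho>_def)
    next
      case False
      then have "bump R (x - y) = 0" "b = R" using R bump_eq_0[of R "x - y"] by (auto simp: b_def \<rho>_def)
      then show ?thesis using R by simp
    qed
    finally show ?thesis .
  qed
  have int_y: "(\<integral>y. H t y \<partial>M) = g t *\<^sub>R riesz_truncated s M t x" for t
    unfolding riesz_truncated_def set_lebesgue_integral_def integral_scaleR_right[symmetric]
    by (intro Bochner_Integration.integral_cong) (auto simp: H_def K_def mult.commute)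
  have Hint1: "integrable N (\<lambda>t. g t *\<^sub>R riesz_truncated s M t x)"
    using P.integrable_fst[OF Hint] unfolding int_y .
  have gN: "integrable N g"
    using weight_density_integrable[OF s R(1) order_refl]
    unfolding N_def g_def set_integrable_def by (subst integrable_restrict_space) auto
  have g0: "(\<integral>t. g t \<partial>N) = 0"
  proof -
    have "(\<integral>t. g t \<partial>N) = (LINT t:{0<..<R}|lborel. g t)"
      unfolding N_def set_lebesgue_integral_def by (subst integral_restrict_space) auto
    also have "\<dots> = weight_primitive s R R"
      unfolding g_def using weight_density_integral[OF s R(1), of R] R by simp
    finally show ?thesis using R by (simp add: weight_primitive_def[OF s R(1)])
  qed
  have "bfield R x = (\<integral>y. (\<integral>t. H t y \<partial>N) \<partial>M)" unfolding bfield_def int_t ..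
  also have "\<dots> = (\<integral>t. (\<integral>y. H t y \<partial>M) \<partial>N)" by (rule P.Fubini_integral[OF Hint])
  also have "\<dots> = (\<integral>t. g t *\<^sub>R riesz_truncated s M t x \<partial>N) - (\<integral>t. g t \<partial>N) *\<^sub>R riesz_truncated s M R x"
    unfolding int_y g0 by simp
  also have "\<dots> = (\<integral>t. g t *\<^sub>R (riesz_truncated s M t x - riesz_truncated s M R x) \<partial>N)"
    using gN Hint1 by (simp add: scaleR_diff_right)
  also have "norm \<dots> \<le> (\<integral>t. norm (g t *\<^sub>R (riesz_truncated s M t x - riesz_truncated s M R x)) \<partial>N)"
    by (rule integral_norm_bound)
  also have "\<dots> \<le> (\<integral>t. (s + 5) * R powr s * \<eta> \<partial>N)"
  proof (rule integral_mono)
    show "integrable N (\<lambda>t. norm (g t *\<^sub>R (riesz_truncated s M t x - riesz_truncated s M R x)))"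
      using gN Hint1 by (intro integrable_norm) (simp add: scaleR_diff_right)
    fix t assume "t \<in> space N"
    then have t: "0 < t" "t < R" by (auto simp: spN)
    have "\<bar>g t\<bar> \<le> (s + 5) * t powr s" unfolding g_def by (rule weight_density_bound[OF s R(1) t])
    also have "\<dots> \<le> (s + 5) * R powr s" using s t by (intro mult_left_mono powr_mono2) auto
    finally show "norm (g t *\<^sub>R (riesz_truncated s M t x - riesz_truncated s M R x)) \<le> (s + 5) * R powr s * \<eta>"
      unfolding norm_scaleR using osc[of t R] t R s by (intro mult_mono) auto
  qed simp
  also have "\<dots> = (s + 5) * \<eta> * R powr (s + 1)"
    using R by (simp add: spN N_def measure_restrict_space powr_add)
  finally show ?thesis .
qed

section \<open>The trace inequality at a good scale\<close>

text \<open>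
  Otherwise all points lie near a subspace of dimension at most \<open>n\<close>, and a grid of mesh \<open>d r\<close> in that
  subspace covers them by about \<open>d\<^sup>-\<^sup>n\<close> balls of measure \<open>O((d r)\<^sup>s)\<close>.
\<close>

lemma exists_point_far_from_subspace:
  fixes F :: "'a::euclidean_space set"
  assumes s: "0 < s" and C: "0 \<le> C" and r: "0 < r" and d: "0 < d" "d \<le> 1"
    and growth: "\<And>x \<rho>. x \<in> F \<Longrightarrow> 0 < \<rho> \<Longrightarrow> hausdorff_measure s (F \<inter> cball x \<rho>) \<le> ennreal (C * \<rho> powr s)"
    and lower: "ennreal (r powr s / 2) \<le> hausdorff_measure s (F \<inter> cball x0 r)"
    and B: "finite B" "pairwise orthogonal B" "\<And>b. b \<in> B \<Longrightarrow> norm b = 1" "card B \<le> n"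
    and small: "(5 / d) ^ n * (C * ((real n + 2) * d) powr s) < 1 / 2"
  shows "\<exists>x\<in>F \<inter> cball x0 r. d * r \<le> norm ((x - x0) - (\<Sum>b\<in>B. ((x - x0) \<bullet> b) *\<^sub>R b))"
proof (rule ccontr)
  assume "\<not> ?thesis"
  then have near: "norm ((x - x0) - (\<Sum>b\<in>B. ((x - x0) \<bullet> b) *\<^sub>R b)) < d * r" if "x \<in> F \<inter> cball x0 r" for x
    using that by (meson not_le)
  define S where "S = F \<inter> cball x0 r"
  \<comment> \<open>The grid cell of the projection of x - x0, in units of \<open>d * r\<close>.
    Restriction to \<open>B\<close> places the values in a finite \<open>PiE\<close> set, whose
    cardinality counts the cells.\<close>
  define h where "h = (\<lambda>x. \<lambda>b\<in>B. \<lfloor>((x - x0) \<bullet> b) / (d * r)\<rfloor>)"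
  define N where "N = \<lceil>1 / d\<rceil>"
  have dr: "0 < d * r" using d r by simp
  have hS: "h ` S \<subseteq> (\<Pi>\<^sub>E b\<in>B. {- N..N})"
  proof (intro image_subsetI PiE_I)
    fix x b assume x: "x \<in> S" and b: "b \<in> B"
    have "\<bar>(x - x0) \<bullet> b\<bar> \<le> norm (x - x0) * norm b" by (rule Cauchy_Schwarz_ineq2)
    also have "\<dots> \<le> r" using x B(3)[OF b] by (simp add: S_def dist_norm norm_minus_commute)
    finally have le: "\<bar>((x - x0) \<bullet> b) / (d * r)\<bar> \<le> 1 / d"
      using dr d r by (simp add: divide_simps mult.commute)
    have N: "1 / d \<le> of_int N" unfolding N_def by (rule le_of_int_ceiling)
    have "- of_int N \<le> ((x - x0) \<bullet> b) / (d * r)" "((x - x0) \<bullet> b) / (d * r) < of_int N + 1"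
      using le[unfolded abs_le_iff] N by linarith+
    then have "\<lfloor>((x - x0) \<bullet> b) / (d * r)\<rfloor> \<in> {- N..N}"
      by (simp add: le_floor_iff floor_le_iff)
    then show "h x b \<in> {- N..N}" using b by (simp add: h_def)
  qed (simp add: h_def)
  have finP: "finite (\<Pi>\<^sub>E b\<in>B. {- N..N})" using B(1) by (intro finite_PiE) auto
  have fin: "finite (h ` S)" by (rule finite_subset[OF hS finP])
  have N0: "1 \<le> N" using d unfolding N_def by (simp add: one_le_ceiling less_le_trans)
  have "real_of_int N \<le> 1 / d + 1" unfolding N_def by linarith
  moreover have "1 \<le> 1 / d" using d by simp
  \<comment> \<open>2N + 1 is at most 2/d + 3, and d \<le> 1 allows 3 to be replaced by 3/d.\<close>
  ultimately have N5: "real_of_int (2 * N + 1) \<le> 5 / d" by simp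
  have "real (card (h ` S)) \<le> real (card (\<Pi>\<^sub>E b\<in>B. {- N..N}))"
    using card_mono[OF finP hS] by simp
  also have "\<dots> = real_of_int (2 * N + 1) ^ card B"
    using B(1) N0 by (simp add: card_PiE)
  also have "\<dots> \<le> (5 / d) ^ card B" using N5 N0 by (intro power_mono) auto
  also have "\<dots> \<le> (5 / d) ^ n" using B(4) d by (intro power_increasing) auto
  finally have card: "real (card (h ` S)) \<le> (5 / d) ^ n" .
  \<comment> \<open>Two points of one cell are each within \<open>d * r\<close> of their
    projections, and these differ by at most \<open>d * r\<close> in each of at most
    \<open>n\<close> coordinates.\<close>
  have dist: "norm (x - y) \<le> (real n + 2) * d * r" if x: "x \<in> S" and y: "y \<in> S" and eq: "h x = h y" for x y
  proof -
    let ?P = "\<lambda>z. (\<Sum>b\<in>B. ((z - x0) \<bullet> b) *\<^sub>R b)"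
    have "norm (?P x - ?P y) = norm (\<Sum>b\<in>B. ((x - y) \<bullet> b) *\<^sub>R b)"
      by (simp add: sum_subtractf[symmetric] inner_diff_left algebra_simps)
    also have "\<dots> \<le> (\<Sum>b\<in>B. d * r)"
    proof (rule sum_norm_le)
      fix b assume b: "b \<in> B"
      have "\<lfloor>((x - x0) \<bullet> b) / (d * r)\<rfloor> = \<lfloor>((y - x0) \<bullet> b) / (d * r)\<rfloor>"
        using fun_cong[OF eq, of b] b by (simp add: h_def)
      then have "\<bar>((x - x0) \<bullet> b) / (d * r) - ((y - x0) \<bullet> b) / (d * r)\<bar> \<le> 1" by linarith
      also have "((x - x0) \<bullet> b) / (d * r) - ((y - x0) \<bullet> b) / (d * r) = ((x - y) \<bullet> b) / (d * r)"
        by (simp add: inner_diff_left diff_divide_distrib)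
      finally have "\<bar>(x - y) \<bullet> b\<bar> \<le> d * r" using dr by (simp add: abs_divide)
      then show "norm (((x - y) \<bullet> b) *\<^sub>R b) \<le> d * r" using B(3)[OF b] by simp
    qed
    also have "\<dots> \<le> real n * (d * r)" using B(4) dr by (simp add: mult_right_mono)
    finally have P: "norm (?P x - ?P y) \<le> real n * (d * r)" .
    have "norm (u - v + w) \<le> norm u + norm v + norm w" for u v w :: 'a
      using norm_triangle_ineq[of "u - v" w] norm_triangle_ineq4[of u v] by linarith
    from this[of "(x - x0) - ?P x" "(y - x0) - ?P y" "?P x - ?P y"]
    have "norm (x - y) \<le> norm ((x - x0) - ?P x) + norm ((y - x0) - ?P y) + norm (?P x - ?P y)"
      by simp
    also have "\<dots> \<le> d * r + d * r + real n * (d * r)"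
      using near x y P by (intro add_mono) (auto simp: S_def less_imp_le)
    finally show ?thesis by (simp add: algebra_simps)
  qed
  define \<rho> where "\<rho> = (real n + 2) * d * r"
  have \<rho>: "0 < \<rho>" using d r by (simp add: \<rho>_def)
  have piece: "hausdorff_measure s {x\<in>S. h x = v} \<le> ennreal (C * \<rho> powr s)" if "v \<in> h ` S" for v
  proof -
    obtain z where z: "z \<in> S" "v = h z" using \<open>v \<in> h ` S\<close> by auto
    \<comment> \<open>The ball is centred at a point of the piece, because \<open>growth\<close> is
      available only at points of \<open>F\<close>.\<close>
    have "{x\<in>S. h x = v} \<subseteq> F \<inter> cball z \<rho>"
      using dist[of z] z by (auto simp: S_def dist_norm \<rho>_def)
    then have "hausdorff_measure s {x\<in>S. h x = v} \<le> hausdorff_measure s (F \<inter> cball z \<rho>)"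
      by (rule hausdorff_measure_mono)
    also have "\<dots> \<le> ennreal (C * \<rho> powr s)" using z by (intro growth \<rho>) (auto simp: S_def)
    finally show ?thesis .
  qed
  have "hausdorff_measure s S = hausdorff_measure s (\<Union>v\<in>h ` S. {x\<in>S. h x = v})"
    by (rule arg_cong[of _ _ "hausdorff_measure s"]) auto
  also have "\<dots> \<le> (\<Sum>v\<in>h ` S. hausdorff_measure s {x\<in>S. h x = v})"
    by (rule hausdorff_measure_UN_finite[OF fin])
  also have "\<dots> \<le> (\<Sum>v\<in>h ` S. ennreal (C * \<rho> powr s))" by (rule sum_mono[OF piece])
  also have "\<dots> = ennreal (real (card (h ` S)) * (C * \<rho> powr s))"
    using C by (simp add: ennreal_mult ennreal_of_nat_eq_real_of_nat)
  also have "\<dots> \<le> ennreal ((5 / d) ^ n * (C * \<rho> powr s))"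
    using card C by (intro ennreal_leI mult_right_mono) auto
  also have "(5 / d) ^ n * (C * \<rho> powr s) = (5 / d) ^ n * (C * ((real n + 2) * d) powr s) * r powr s"
    using d r by (simp add: \<rho>_def powr_mult)
  also have "ennreal \<dots> < ennreal (r powr s / 2)"
    using small mult_strict_right_mono[OF small, of "r powr s"] r by (intro ennreal_lessI) auto
  also have "\<dots> \<le> hausdorff_measure s S" using lower by (simp add: S_def)
  finally show False by simp
qed

context finite_euclidean_measure
begin

text \<open>The scale maximises \<open>bmass R / R powr p\<close> along a geometric sequence.\<close>

lemma exists_good_scale:
  assumes p: "s < p" and C: "0 \<le> C" and l: "1 < l" and R0: "0 < R0"
    and growth: "\<And>R. 0 < R \<Longrightarrow> measure M (cball x R) \<le> C * R powr s"
    and pos: "0 < bmass R0 x"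
  obtains n where "\<And>j. bmass (l ^ (n + j) * R0) x \<le> (l powr p) ^ j * bmass (l ^ n * R0) x"
    and "(l powr (p - s)) ^ n * bmass R0 x \<le> C * R0 powr s"
proof -
  define a where "a = l powr (p - s)"
  have a: "1 < a" using l p by (simp add: a_def)
  have lp: "l powr p = l powr s * a" by (simp add: a_def flip: powr_add)
  have lp0: "0 < l powr p" using l by simp
  \<comment> \<open>The mass grows at most like R^s with s < p, so this ratio tends to 0 and attains
    its maximum.\<close>
  define f where "f = (\<lambda>n. bmass (l ^ n * R0) x / (l powr p) ^ n)"
  have f0: "0 \<le> f n" for n by (auto simp: f_def bmass_def intro!: integral_nonneg)
  have fle: "f n \<le> C * R0 powr s * (1 / a) ^ n" for n
  proof -
    have lR: "0 < l ^ n * R0" using l R0 by simp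
    have "bmass (l ^ n * R0) x \<le> C * (l ^ n * R0) powr s"
      using bmass_le_measure[OF lR, of x] growth[OF lR] by linarith
    also have "(l ^ n * R0) powr s = (l powr s) ^ n * R0 powr s"
      using l R0 by (simp add: powr_mult powr_power powr_powr mult.commute flip: powr_realpow)
    finally have "f n \<le> C * ((l powr s) ^ n * R0 powr s) / (l powr p) ^ n"
      unfolding f_def using lp0 by (intro divide_right_mono) auto
    also have "\<dots> = C * R0 powr s * (1 / a) ^ n"
      unfolding lp using l a by (simp add: power_mult_distrib power_divide)
    finally show ?thesis .
  qed
  have "(\<lambda>n. C * R0 powr s * (1 / a) ^ n) \<longlonglongrightarrow> C * R0 powr s * 0"
    using a by (intro tendsto_mult tendsto_const LIMSEQ_power_zero) auto
  then have "f \<longlonglongrightarrow> 0"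
    by (intro tendsto_sandwich[of "\<lambda>_. 0" f sequentially "\<lambda>n. C * R0 powr s * (1 / a) ^ n"]) (auto simp: f0 fle)
  moreover have "0 < f 0" using pos by (simp add: f_def)
  ultimately obtain n where n: "\<And>m. f m \<le> f n" using null_sequence_attains_max by blast
  show ?thesis
  proof (rule that)
    fix j
    have "f (n + j) \<le> f n" by (rule n)
    then show "bmass (l ^ (n + j) * R0) x \<le> (l powr p) ^ j * bmass (l ^ n * R0) x"
      using lp0 by (simp add: f_def power_add field_simps)
  next
    \<comment> \<open>Comparing the maximum with index 0 limits the number \<open>n\<close> of
      dilations.\<close>
    have "bmass R0 x \<le> C * R0 powr s * (1 / a) ^ n" using n[of 0] fle[of n] by (simp add: f_def)
    then show "(l powr (p - s)) ^ n * bmass R0 x \<le> C * R0 powr s"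
      using a unfolding a_def[symmetric] by (simp add: power_divide field_simps)
  qed
qed

text \<open>The field is small at \<open>x0\<close> and at nearby points of \<open>F\<close>, so by
  Taylor expansion \<open>bderiv\<close> is small on their differences. Thickness extracts
  \<open>k\<close> orthonormal vectors with small image, and the trace inequality on them gives the
  bound.\<close>

lemma dimension_defect_le:
  assumes r: "0 < r" "r \<le> R" and d: "0 < d" and x0: "x0 \<in> F"
    and field: "\<And>x. x \<in> F \<Longrightarrow> norm (bfield R x) \<le> \<beta>"
    and thick: "\<And>B. finite B \<Longrightarrow> pairwise orthogonal B \<Longrightarrow> (\<And>b. b \<in> B \<Longrightarrow> norm b = 1) \<Longrightarrow> card B < k \<Longrightarrow>
      \<exists>x\<in>F \<inter> cball x0 r. d * r \<le> norm ((x - x0) - (\<Sum>b\<in>B. ((x - x0) \<bullet> b) *\<^sub>R b))"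
  shows "real k * bmass R x0 - bmoment R x0
    \<le> real k * (((1 + real k) / d + 1) ^ k * (100 * r\<^sup>2 / R * measure M (cball x0 (2 * R)) + 2 * \<beta>) / r)"
proof -
  have R: "0 < R" using r by simp
  define \<tau> where "\<tau> = 100 * r\<^sup>2 / R * measure M (cball x0 (2 * R)) + 2 * \<beta>"
  define S where "S = (\<lambda>x. x - x0) ` (F \<inter> cball x0 r)"
  have \<beta>: "0 \<le> \<beta>" using order_trans[OF norm_ge_zero field[OF x0]] .
  have \<tau>: "0 \<le> \<tau>" using \<beta> R by (simp add: \<tau>_def)
  have S1: "norm w \<le> r" if "w \<in> S" for w
    using that by (auto simp: S_def dist_norm norm_minus_commute)
  have S2: "norm (bderiv R x0 w) \<le> \<tau>" if w: "w \<in> S" for w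
  proof -
    have wr: "norm w \<le> r" by (rule S1[OF w])
    have "x0 + w \<in> F" using w by (auto simp: S_def)
    then have f: "norm (bfield R (x0 + w)) \<le> \<beta>" by (rule field)
    have "(norm w)\<^sup>2 \<le> r\<^sup>2" using wr by (intro power_mono) auto
    then have "100 * (norm w)\<^sup>2 / R * measure M (cball x0 (2 * R)) \<le> 100 * r\<^sup>2 / R * measure M (cball x0 (2 * R))"
      using R by (intro mult_right_mono divide_right_mono) auto
    moreover have "norm (bfield R (x0 + w) - bfield R x0 - bderiv R x0 w)
        \<le> 100 * (norm w)\<^sup>2 / R * measure M (cball x0 (2 * R))"
      using wr r by (intro bfield_taylor R) simp
    moreover have "norm (bderiv R x0 w) \<le> norm (bfield R (x0 + w)) + norm (bfield R x0)
        + norm (bfield R (x0 + w) - bfield R x0 - bderiv R x0 w)"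
      using norm_triangle_ineq4[of "bfield R (x0 + w) - bfield R x0" "bfield R (x0 + w) - bfield R x0 - bderiv R x0 w"]
        norm_triangle_ineq4[of "bfield R (x0 + w)" "bfield R x0"] by simp
    ultimately show ?thesis using f field[OF x0] unfolding \<tau>_def by linarith
  qed
  have thickS: "\<exists>w\<in>S. d * r \<le> norm (w - (\<Sum>b\<in>B. (w \<bullet> b) *\<^sub>R b))"
    if "finite B" "pairwise orthogonal B" "\<And>b. b \<in> B \<Longrightarrow> norm b = 1" "card B < k" for B
    using thick[OF that] unfolding S_def by auto
  obtain B where B: "finite B" "pairwise orthogonal B" "\<forall>b\<in>B. norm b = 1" "card B = k"
    "\<forall>b\<in>B. norm (bderiv R x0 b) \<le> ((1 + real k) / d + 1) ^ k * \<tau> / r"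
    using orthonormal_extension_bound[OF linear_bderiv[OF R] d r(1) \<tau> S1 S2 thickS order_refl] by blast
  have "real k * bmass R x0 - bmoment R x0 \<le> (\<Sum>e\<in>B. bderiv R x0 e \<bullet> e)"
    using bderiv_trace_ge[OF R B(1,2)] B(3,4) by auto
  also have "\<dots> \<le> (\<Sum>e\<in>B. ((1 + real k) / d + 1) ^ k * \<tau> / r)"
  proof (rule sum_mono)
    fix e assume e: "e \<in> B"
    have "bderiv R x0 e \<bullet> e \<le> norm (bderiv R x0 e) * norm e" by (rule norm_cauchy_schwarz)
    then show "bderiv R x0 e \<bullet> e \<le> ((1 + real k) / d + 1) ^ k * \<tau> / r" using B(3,5) e by force
  qed
  finally show ?thesis using B(4) by (simp add: \<tau>_def)
qed

end

section \<open>Non-integer dimensions force oscillation\<close>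

lemma exists_small_scale_ratio:
  fixes C s :: real
  assumes C: "0 \<le> C" and s: "0 < s" "real n < s"
  obtains d where "0 < d" "d \<le> 1" "(5 / d) ^ n * (C * ((real n + 2) * d) powr s) < 1 / 2"
proof -
  define Q where "Q = 5 ^ n * (C * (real n + 2) powr s) + 1"
  have Q: "1 \<le> Q" using C by (simp add: Q_def)
  \<comment> \<open>This solves \<open>d powr (s - n) = 1 / (2 * Q)\<close>, which is possible as s
    > n; the quantity to bound becomes (Q - 1) / (2Q).\<close>
  define d where "d = (1 / (2 * Q)) powr (1 / (s - n))"
  have d0: "0 < d" using Q by (simp add: d_def)
  have d1: "d \<le> 1" unfolding d_def using Q s by (intro powr_le1) auto
  have "d powr (s - n) = 1 / (2 * Q)" using Q s by (simp add: d_def powr_powr)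
  then have dd: "d powr s / d ^ n = 1 / (2 * Q)" using d0 by (simp add: powr_diff powr_realpow)
  have "(5 / d) ^ n * (C * ((real n + 2) * d) powr s)
      = 5 ^ n * (C * (real n + 2) powr s) * (d powr s / d ^ n)"
    using d0 by (simp add: powr_mult power_divide)
  also have "\<dots> = (Q - 1) * (1 / (2 * Q))" unfolding dd by (simp add: Q_def)
  also have "\<dots> < 1 / 2" using Q by (simp add: field_simps)
  finally show ?thesis using d0 d1 that by blast
qed

text \<open>The constants come before \<open>E\<close>, \<open>F\<close>, \<open>x0\<close>,
  \<open>r\<close> and \<delta>, because the final argument selects \<open>F\<close> by means of
  \<eta>.\<close>

lemma truncated_oscillation_lower_bound:
  fixes s C :: real
  assumes C: "0 < C" and k: "real k < s + 1" "s < real k" and s: "0 < s"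
  obtains \<eta> K where "0 < \<eta>" "0 < K"
    "\<And>(E :: (real^'m) set) F x0 r \<delta>.
      \<lbrakk>F \<subseteq> E; hausdorff_measure s E < top; x0 \<in> F; 0 < r; K * r < \<delta>;
       \<And>x \<rho>. x \<in> F \<Longrightarrow> 0 < \<rho> \<Longrightarrow> hausdorff_measure s (E \<inter> cball x \<rho>) \<le> ennreal (C * \<rho> powr s);
       ennreal (r powr s / 2) \<le> hausdorff_measure s (F \<inter> cball x0 r);
       \<And>x a b. x \<in> F \<Longrightarrow> 0 < a \<Longrightarrow> a < \<delta> \<Longrightarrow> 0 < b \<Longrightarrow> b < \<delta> \<Longrightarrow>
         norm (riesz_truncated s (hausdorff_restr s E) a x - riesz_truncated s (hausdorff_restr s E) b x) \<le> \<eta>\<rbrakk>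
      \<Longrightarrow> False"
proof -
  \<comment> \<open>Between \<open>s\<close> and \<open>k\<close>, \<open>p\<close> is the growth
    exponent used to select the scale and \<open>q\<close> the resulting bound for moment over
    mass.\<close>
  define p where "p = (s + real k) / 2"
  define q where "q = (p + real k) / 2"
  have pq: "s < p" "p < q" "q < real k" using k by (auto simp: p_def q_def)
  obtain l where l: "1 < l" "2 * (l powr p - 1) \<le> q * (1 - 1 / l\<^sup>2)"
    using exists_dilation_factor[OF pq(2)] by blast
  \<comment> \<open>\<open>J\<close> dilations by \<open>l\<close> reach beyond radius 3R, as the
    doubling estimate requires.\<close>
  obtain J where J: "3 < l ^ J" using real_arch_pow[OF l(1)] by blast
  have k1: "1 \<le> k" using k s by (cases k) auto
  obtain d where d: "0 < d" "d \<le> 1" "(5 / d) ^ (k - 1) * (C * ((real (k - 1) + 2) * d) powr s) < 1 / 2"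
    by (rule exists_small_scale_ratio[of C s "k - 1"]) (use C s k k1 in auto)
  define Q where "Q = real k * ((1 + real k) / d + 1) ^ k"
  have Q: "0 < Q" using k1 d by (auto simp: Q_def intro!: mult_pos_pos zero_less_power add_nonneg_pos)
  define D where "D = 4 * (l powr p) ^ J"
  have D: "0 < D" using l by (simp add: D_def)
  \<comment> \<open>Lower bound for R / r: it makes the Taylor error at most half of
    \<open>(real k - q) * A\<close>.\<close>
  define M0 where "M0 = max 2 (200 * Q * D / (real k - q))"
  have M0: "2 \<le> M0" "200 * Q * D / (real k - q) \<le> M0" by (simp_all add: M0_def)
  \<comment> \<open>Upper bound for R / r: the first factor bounds \<open>l ^ n\<close>.\<close>
  define M1 where "M1 = (4 * C * M0 powr s) powr (1 / (p - s)) * M0"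
  have M1: "0 < M1" using C M0 by (simp add: M1_def)
  \<comment> \<open>Chosen so that the field error is at most
    \<open>(real k - q) / 16 * r powr s\<close>.\<close>
  define \<eta> where "\<eta> = (real k - q) / (32 * Q * (s + 5) * M1 powr (s + 1))"
  have \<eta>: "0 < \<eta>" using pq Q s M1 by (simp add: \<eta>_def)
  show ?thesis
  proof (rule that[OF \<eta> M1])
    fix E F :: "(real^'m) set" and x0 r \<delta>
    assume FE: "F \<subseteq> E" and fin: "hausdorff_measure s E < top" and x0: "x0 \<in> F" and r: "0 < r"
      and r\<delta>: "M1 * r < \<delta>"
      and growth: "\<And>x \<rho>. x \<in> F \<Longrightarrow> 0 < \<rho> \<Longrightarrow> hausdorff_measure s (E \<inter> cball x \<rho>) \<le> ennreal (C * \<rho> powr s)"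
      and lower: "ennreal (r powr s / 2) \<le> hausdorff_measure s (F \<inter> cball x0 r)"
      and osc: "\<And>x a b. x \<in> F \<Longrightarrow> 0 < a \<Longrightarrow> a < \<delta> \<Longrightarrow> 0 < b \<Longrightarrow> b < \<delta> \<Longrightarrow>
         norm (riesz_truncated s (hausdorff_restr s E) a x - riesz_truncated s (hausdorff_restr s E) b x) \<le> \<eta>"
    define M where "M = hausdorff_restr s E"
    have em: "emeasure M A = hausdorff_measure s (E \<inter> A)" if "A \<in> sets borel" for A
      unfolding M_def using s that by (intro emeasure_hausdorff_restr) auto
    have fem: "finite_euclidean_measure M"
    proof (intro finite_euclidean_measure.intro finite_measureI finite_euclidean_measure_axioms.intro)
      show "emeasure M (space M) \<noteq> \<infinity>" using fin em[of UNIV] by (simp add: M_def)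
    qed (simp add: M_def)
    interpret finite_euclidean_measure M by (rule fem)
    have mgrowth: "measure M (cball x0 \<rho>) \<le> C * \<rho> powr s" if "0 < \<rho>" for \<rho>
    proof -
      have "ennreal (measure M (cball x0 \<rho>)) \<le> ennreal (C * \<rho> powr s)"
        using growth[OF x0 that] em[of "cball x0 \<rho>"] by (simp add: emeasure_eq_measure)
      then show ?thesis using C by (simp add: ennreal_le_iff)
    qed
    have "ennreal (r powr s / 2) \<le> ennreal (measure M (cball x0 r))"
      using lower hausdorff_measure_mono[of "F \<inter> cball x0 r" "E \<inter> cball x0 r" s] FE em[of "cball x0 r"]
      by (auto simp: emeasure_eq_measure[symmetric] intro: order_trans)
    then have mlower: "r powr s / 2 \<le> measure M (cball x0 r)" by simp
    define R0 where "R0 = M0 * r"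
    have R0: "0 < R0" "2 * r \<le> R0" using M0 r by (auto simp: R0_def)
    have b0: "r powr s / 4 \<le> bmass R0 x0"
    proof -
      \<comment> \<open>Half the radius 2r is r, where the squared bump is at least 9/16, and 9/32
        exceeds 1/4.\<close>
      have "r powr s / 4 \<le> 9 / 16 * measure M (cball x0 r)"
        using mlower powr_ge_zero[of r s] by linarith
      also have "\<dots> = (1 - (1 / 2)\<^sup>2)\<^sup>2 * measure M (cball x0 (1 / 2 * (2 * r)))"
        by (simp add: power2_eq_square)
      also have "\<dots> \<le> bmass (2 * r) x0" using r by (intro measure_le_bmass) auto
      also have "\<dots> \<le> bmass R0 x0" using R0 r by (intro bmass_mono) auto
      finally show ?thesis .
    qed
    have rs: "0 < r powr s" using r by simp
    have b0': "0 < bmass R0 x0" using b0 rs by linarith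
    obtain n where n: "\<And>j. bmass (l ^ (n + j) * R0) x0 \<le> (l powr p) ^ j * bmass (l ^ n * R0) x0"
      "(l powr (p - s)) ^ n * bmass R0 x0 \<le> C * R0 powr s"
      by (rule exists_good_scale[OF pq(1) less_imp_le[OF C] l(1) R0(1) mgrowth b0']) (assumption, rule that)
    define R where "R = l ^ n * R0"
    have ln: "1 \<le> l ^ n" using l by simp
    have R: "0 < R" "R0 \<le> R" using R0 ln l mult_right_mono[OF ln, of R0] by (auto simp: R_def)
    have bR: "bmass R0 x0 \<le> bmass R x0" using R R0 by (intro bmass_mono) auto
    define A where "A = bmass R x0"
    have A: "r powr s / 4 \<le> A" using b0 bR by (simp add: A_def)
    then have A0: "0 < A" using rs by linarith
    have RM1: "R \<le> M1 * r"
    proof -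
      have "(l powr (p - s)) ^ n * (r powr s / 4) \<le> (l powr (p - s)) ^ n * bmass R0 x0"
        using b0 by (intro mult_left_mono) auto
      also have "\<dots> \<le> C * (M0 powr s * r powr s)"
        using n(2) M0 r by (simp add: R0_def powr_mult)
      finally have "(l powr (p - s)) ^ n * r powr s \<le> (4 * C * M0 powr s) * r powr s" by simp
      then have "(l powr (p - s)) ^ n \<le> 4 * C * M0 powr s" using rs by simp
      then have "((l powr (p - s)) ^ n) powr (1 / (p - s)) \<le> (4 * C * M0 powr s) powr (1 / (p - s))"
        using pq l by (intro powr_mono2) auto
      moreover have "((l powr (p - s)) ^ n) powr (1 / (p - s)) = l ^ n"
        using pq l by (simp add: powr_power powr_powr powr_realpow)
      ultimately show ?thesis using R0 r M0 by (simp add: R_def R0_def M1_def mult.assoc)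
    qed
    have moment: "bmoment R x0 \<le> q * A"
    proof -
      \<comment> \<open>Maximality at one dilation step bounds the finite difference of the mass;
        the choice of \<open>l\<close> converts the exponent \<open>p\<close> into the factor
        \<open>q\<close>.\<close>
      have "(1 - 1 / l\<^sup>2) / 2 * bmoment R x0 \<le> bmass (l * R) x0 - bmass R x0"
        by (rule bmoment_le_dilation[OF R(1) l(1)])
      also have "bmass (l * R) x0 \<le> l powr p * bmass R x0"
        using n(1)[of 1] by (simp add: R_def mult.assoc)
      also have "l powr p * bmass R x0 - bmass R x0 = (l powr p - 1) * A" by (simp add: A_def algebra_simps)
      also have "\<dots> \<le> (q * (1 - 1 / l\<^sup>2) / 2) * A" using l(2) A0 by (intro mult_right_mono) auto
      finally have "(1 - 1 / l\<^sup>2) / 2 * bmoment R x0 \<le> (1 - 1 / l\<^sup>2) / 2 * (q * A)" by (simp add: mult_ac)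
      moreover have "0 < (1 - 1 / l\<^sup>2) / 2" using l by (simp add: one_less_power)
      ultimately show ?thesis by (rule mult_left_le_imp_le)
    qed
    have doubling: "measure M (cball x0 (2 * R)) \<le> D * A"
    proof -
      \<comment> \<open>On the ball of radius 2R the squared bump of radius 3R is at least 25/81,
        which exceeds 1/4.\<close>
      have "measure M (cball x0 (2 * R)) / 4 \<le> (1 - (2 / 3)\<^sup>2)\<^sup>2 * measure M (cball x0 (2 / 3 * (3 * R)))"
        by (simp add: power2_eq_square)
      also have "\<dots> \<le> bmass (3 * R) x0" using R by (intro measure_le_bmass) auto
      also have "\<dots> \<le> bmass (l ^ J * R) x0" using R J by (intro bmass_mono) auto
      also have "\<dots> \<le> (l powr p) ^ J * A" using n(1)[of J] by (simp add: R_def A_def power_add mult_ac)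
      finally show ?thesis by (simp add: D_def)
    qed
    define \<beta> where "\<beta> = (s + 5) * \<eta> * R powr (s + 1)"
    have field: "norm (bfield R x) \<le> \<beta>" if "x \<in> F" for x
      unfolding \<beta>_def
      by (rule norm_bfield_le_of_truncated_oscillation[OF fem s R(1), of \<delta>])
         (use RM1 r\<delta> osc[OF that] in \<open>auto simp: M_def\<close>)
    have Fgrowth: "hausdorff_measure s (F \<inter> cball x \<rho>) \<le> ennreal (C * \<rho> powr s)" if "x \<in> F" "0 < \<rho>" for x \<rho>
      using hausdorff_measure_mono[of "F \<inter> cball x \<rho>" "E \<inter> cball x \<rho>" s] FE growth[OF that] by (auto intro: order_trans)
    have thick: "\<exists>x\<in>F \<inter> cball x0 r. d * r \<le> norm ((x - x0) - (\<Sum>b\<in>B. ((x - x0) \<bullet> b) *\<^sub>R b))"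
      if "finite B" "pairwise orthogonal B" "\<And>b. b \<in> B \<Longrightarrow> norm b = 1" "card B < k" for B :: "(real^'m) set"
      using exists_point_far_from_subspace[OF s less_imp_le[OF C] r d(1,2) Fgrowth lower that(1-3) _ d(3)] that(4) by simp
    have rR: "r \<le> R" using R R0 r by linarith
    have "real k * bmass R x0 - bmoment R x0
      \<le> real k * (((1 + real k) / d + 1) ^ k * (100 * r\<^sup>2 / R * measure M (cball x0 (2 * R)) + 2 * \<beta>) / r)"
      by (rule dimension_defect_le[OF r rR d(1) x0 field thick])
    also have "\<dots> = Q * (100 * (r / R) * measure M (cball x0 (2 * R)) + 2 * \<beta> / r)"
      using r by (simp add: Q_def power2_eq_square field_simps)
    also have "\<dots> \<le> Q * (100 * (1 / M0) * (D * A) + 2 * \<beta> / r)"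
    proof -
      have "M0 * r \<le> R" using R by (simp add: R0_def)
      then have "r / R \<le> 1 / M0" using R M0 by (simp add: field_simps)
      then show ?thesis using Q M0 doubling
        by (intro mult_left_mono add_right_mono mult_mono) auto
    qed
    also have "\<dots> = (100 * Q * D / M0) * A + Q * (2 * \<beta> / r)" by (simp add: algebra_simps)
    also have "\<dots> \<le> (real k - q) / 2 * A + Q * (2 * \<beta> / r)"
    proof -
      have "200 * Q * D \<le> M0 * (real k - q)" using M0(2) pq by (simp add: pos_divide_le_eq)
      then have "100 * Q * D / M0 \<le> (real k - q) / 2" using M0(1) by (simp add: field_simps)
      then show ?thesis using A0 by (intro add_right_mono mult_right_mono) auto
    qed
    finally have "real k * A - q * A \<le> (real k - q) / 2 * A + Q * (2 * \<beta> / r)"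
      using moment by (simp add: A_def)
    moreover have "real k * A - q * A = 2 * ((real k - q) / 2 * A)" by (simp add: algebra_simps)
    \<comment> \<open>The left side is at least \<open>(real k - q) / 8 * r powr s\<close>, while
      the right side is at most half of that.\<close>
    ultimately have "(real k - q) / 2 * A \<le> Q * (2 * \<beta> / r)" by linarith
    moreover have "(real k - q) / 2 * (r powr s / 4) \<le> (real k - q) / 2 * A"
      using A pq by (intro mult_left_mono) auto
    moreover have "Q * (2 * \<beta> / r) \<le> (real k - q) / 16 * r powr s"
    proof -
      have "R powr (s + 1) \<le> (M1 * r) powr (s + 1)" using RM1 R s by (intro powr_mono2) auto
      also have "\<dots> = M1 powr (s + 1) * (r powr s * r)" using M1 r by (simp add: powr_mult powr_add)
      finally have "\<beta> \<le> (s + 5) * \<eta> * (M1 powr (s + 1) * (r powr s * r))"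
        unfolding \<beta>_def using s \<eta> by (intro mult_left_mono) auto
      then have "Q * (2 * \<beta> / r) \<le> Q * (2 * ((s + 5) * \<eta> * (M1 powr (s + 1) * (r powr s * r))) / r)"
        using Q r by (intro mult_left_mono divide_right_mono) auto
      also have "\<dots> = 2 * (Q * (s + 5) * M1 powr (s + 1) * \<eta>) * r powr s" using r by simp
      also have "Q * (s + 5) * M1 powr (s + 1) * \<eta> = (real k - q) / 32"
        using Q s M1 by (simp add: \<eta>_def)
      also have "2 * ((real k - q) / 32) * r powr s = (real k - q) / 16 * r powr s" by simp
      finally show ?thesis .
    qed
    moreover have "(real k - q) / 2 * (r powr s / 4) = 2 * ((real k - q) / 16 * r powr s)" by simp
    ultimately have "(real k - q) / 16 * r powr s \<le> 0" by linarith
    then show False using pq rs by (simp add: mult_le_0_iff)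
  qed
qed

text \<open>Only countable subadditivity of the outer measure enters, so the pieces selected below
  need not be measurable.\<close>

lemma hausdorff_positive_piece:
  assumes "0 < hausdorff_measure s A" "A \<subseteq> (\<Union>n::nat. B n)"
  shows "\<exists>n. 0 < hausdorff_measure s (A \<inter> B n)"
proof (rule ccontr)
  assume "\<not> ?thesis"
  then have "hausdorff_measure s (\<Union>n. A \<inter> B n) = 0"
    by (intro hausdorff_measure_null_UN) (metis not_gr_zero)
  moreover have "(\<Union>n. A \<inter> B n) = A" using assms(2) by auto
  ultimately show False using assms(1) by simp
qed

theorem corollary1:
  fixes s :: real and E :: "(real^'m) set"
  assumes "0 \<le> s" and "s \<le> real CARD('m)"
    and "0 < hausdorff_measure s E" and "hausdorff_measure s E < \<infinity>"
    and "hausdorff_measure s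
           {x \<in> E. \<not> (\<exists>L. ((\<lambda>\<epsilon>. riesz_truncated s (hausdorff_restr s E) \<epsilon> x) \<longlongrightarrow> L) (at_right 0))} = 0"
  shows "s \<in> \<int>"
proof (rule ccontr)
  assume nonint: "s \<notin> \<int>"
  then have "s \<noteq> 0" by auto
  with assms(1) have s: "0 < s" by simp
  have fin: "hausdorff_measure s E < top" using assms(4) by simp
  define T where "T = riesz_truncated s (hausdorff_restr s E)"
  define k where "k = nat \<lfloor>s\<rfloor> + 1"
  have "real_of_int \<lfloor>s\<rfloor> \<noteq> s" using nonint by (metis Ints_of_int)
  then have "real_of_int \<lfloor>s\<rfloor> < s" "s < real_of_int \<lfloor>s\<rfloor> + 1" by linarith+
  moreover have "real k = real_of_int \<lfloor>s\<rfloor> + 1" using s by (simp add: k_def)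
  ultimately have k: "real k < s + 1" "s < real k" by linarith+
  \<comment> \<open>Exceptional points: no principal value, or no finite growth constant valid at
    all radii.\<close>
  define Z where "Z = {x\<in>E. \<not> (\<exists>L. ((\<lambda>\<epsilon>. T \<epsilon> x) \<longlongrightarrow> L) (at_right 0))}
    \<union> {x\<in>E. \<forall>C::real. \<exists>r>0. ennreal (C * r powr s) < hausdorff_measure s (E \<inter> cball x r)}"
  have "hausdorff_measure s Z = 0"
    unfolding Z_def T_def using assms(5) upper_density_finite_ae[OF s fin]
    by (simp add: hausdorff_measure_null_Un)
  moreover have "hausdorff_measure s E \<le> hausdorff_measure s Z + hausdorff_measure s (E - Z)"
    using hausdorff_measure_Un[of s Z "E - Z"] hausdorff_measure_mono[of E "Z \<union> (E - Z)" s]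
    by (auto intro: order_trans)
  ultimately have pos: "0 < hausdorff_measure s (E - Z)" using assms(3) by simp
  define G where "G = (\<lambda>n::nat. {x. \<forall>r>0. hausdorff_measure s (E \<inter> cball x r) \<le> ennreal (real (Suc n) * r powr s)})"
  have "E - Z \<subseteq> (\<Union>n. G n)"
  proof
    fix x assume "x \<in> E - Z"
    then have "\<not> (\<forall>C::real. \<exists>r>0. ennreal (C * r powr s) < hausdorff_measure s (E \<inter> cball x r))"
      unfolding Z_def by simp
    then obtain C :: real where "\<not> (\<exists>r>0. ennreal (C * r powr s) < hausdorff_measure s (E \<inter> cball x r))"
      by blast
    then have C: "hausdorff_measure s (E \<inter> cball x r) \<le> ennreal (C * r powr s)" if "r > 0" for r
      using that by (meson not_less)
    obtain n where n: "C \<le> real n" using real_arch_simple by blast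
    have "hausdorff_measure s (E \<inter> cball x r) \<le> ennreal (real (Suc n) * r powr s)" if "r > 0" for r
    proof (rule order_trans[OF C[OF that]])
      show "ennreal (C * r powr s) \<le> ennreal (real (Suc n) * r powr s)"
        using n by (intro ennreal_leI mult_right_mono) auto
    qed
    then show "x \<in> (\<Union>n. G n)" by (auto simp: G_def)
  qed
  from hausdorff_positive_piece[OF pos this] obtain n where n: "0 < hausdorff_measure s ((E - Z) \<inter> G n)" ..
  have C0: "0 < real (Suc n)" by simp
  show False
  proof (rule truncated_oscillation_lower_bound[OF C0 k s, where 'm = 'm], goal_cases)
    case (1 \<eta> K)
    note \<eta> = 1(1) and K = 1(2) and contra = 1(3)
    \<comment> \<open>Existence of limits is made uniform only now: \<eta> depends on the growth
      constant \<open>Suc n\<close> fixed by the previous selection.\<close>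
    define W where "W = (\<lambda>i::nat. {x. \<forall>a b. 0 < a \<longrightarrow> a < 1 / real (Suc i) \<longrightarrow> 0 < b \<longrightarrow> b < 1 / real (Suc i)
      \<longrightarrow> norm (T a x - T b x) \<le> \<eta>})"
    have "(E - Z) \<inter> G n \<subseteq> (\<Union>i. W i)"
    proof
      fix x assume "x \<in> (E - Z) \<inter> G n"
      then obtain L where "((\<lambda>\<epsilon>. T \<epsilon> x) \<longlongrightarrow> L) (at_right 0)" unfolding Z_def by auto
      then have "eventually (\<lambda>\<epsilon>. dist (T \<epsilon> x) L < \<eta> / 2) (at_right 0)" using \<eta> by (intro tendstoD) auto
      then obtain b where b: "b > 0" "\<And>\<epsilon>. 0 < \<epsilon> \<Longrightarrow> \<epsilon> < b \<Longrightarrow> dist (T \<epsilon> x) L < \<eta> / 2"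
        by (auto simp: eventually_at_right_field)
      obtain i where i: "1 / real (Suc i) < b" using reals_Archimedean[OF b(1)] by (auto simp: field_simps)
      have "norm (T a x - T a' x) \<le> \<eta>" if "0 < a" "a < 1 / real (Suc i)" "0 < a'" "a' < 1 / real (Suc i)" for a a'
        using b(2)[of a] b(2)[of a'] that i dist_triangle_half_l[of "T a x" L \<eta> "T a' x"]
        by (auto simp: dist_norm norm_minus_commute)
      then show "x \<in> (\<Union>i. W i)" by (auto simp: W_def)
    qed
    from hausdorff_positive_piece[OF n this] obtain i where i: "0 < hausdorff_measure s ((E - Z) \<inter> G n \<inter> W i)" ..
    define F where "F = (E - Z) \<inter> G n \<inter> W i"
    have FE: "F \<subseteq> E" by (auto simp: F_def)
    have finF: "hausdorff_measure s F < top" using hausdorff_measure_mono[OF FE] fin by (rule le_less_trans)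
    obtain x0 where x0: "x0 \<in> F" "\<And>\<rho>. \<rho> > 0 \<Longrightarrow>
        \<exists>r. 0 < r \<and> r < \<rho> \<and> ennreal (r powr s / 2) \<le> hausdorff_measure s (F \<inter> cball x0 r)"
      using exists_upper_density_point[OF s _ finF] i unfolding F_def by blast
    \<comment> \<open>The density radius is taken so small that all scales up to
      \<open>K * r\<close> stay below the uniform oscillation threshold.\<close>
    obtain r where r: "0 < r" "r < 1 / real (Suc i) / K" "ennreal (r powr s / 2) \<le> hausdorff_measure s (F \<inter> cball x0 r)"
      using x0(2)[of "1 / real (Suc i) / K"] K by auto
    show False
    proof (rule contra[OF FE fin x0(1) r(1) _ _ r(3)])
      show "K * r < 1 / real (Suc i)" using mult_strict_left_mono[OF r(2) K] K by simp
      show "hausdorff_measure s (E \<inter> cball x \<rho>) \<le> ennreal (real (Suc n) * \<rho> powr s)" if "x \<in> F" "0 < \<rho>" for x \<rho>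
        using that by (auto simp: F_def G_def)
      show "norm (riesz_truncated s (hausdorff_restr s E) a x - riesz_truncated s (hausdorff_restr s E) b x) \<le> \<eta>"
        if "x \<in> F" "0 < a" "a < 1 / real (Suc i)" "0 < b" "b < 1 / real (Suc i)" for x a b
        using that by (auto simp: F_def W_def T_def)
    qed
  qed
qed

end
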